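(* Let $d\ge1$ and let $\mathbf A_0$ be the universal unital $C^*$-algebra generated by elements $t_i,t_i^*$, $i=1,\dots,d$, subject to the relations $$t_i^*t_j=\delta_{ij}\Bigl(1-\sum_{k<i}t_kt_k^*\Bigr),\ i,j=1,\dots,d,\qquad t_jt_i=0,\ j>i.$$ Then the Fock representation of $\mathbf A_0$ is faithful.
   Context: The Fock representation of $\mathbf A_0$ is the irreducible representation $\pi_F$ on a Hilbert space determined (up to unitary equivalence) by a cyclic unit vector $\Omega$ such that $\pi_F(t_i^* )\Omega=0$ for $i=1,\dots,d$. The universal $C^*$-algebra of a unital $*$-algebra $\mathcal A$ given by generators and relations is a $C^*$-algebra $\mathbf A$ with a $*$-homomorphism $\psi\colon\mathcal A\to\mathbf A$ such that for every $*$-homomorphism $\varphi\colon\mathcal A\to B$ into a $C^*$-algebra $B$ there is a $*$-homomorphism $\theta\colon\mathbf A\to B$ with $\theta\psi=\varphi$; it is the completion of $\mathcal A$, modulo the kernel, in the seminorm $\sup_\pi\|\pi(\cdot)\|$ over all bounded representations $\pi$. *)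

theory Defs
  imports "HOL-Analysis.Analysis" "HOL-Algebra.Module"
begin

section \<open>Complex Hilbert spaces and bounded operators\<close>

text \<open>Inner products are linear in the first argument.  The underlying real inner product is
  the real part, so that the norm, the topology and completeness are those of the classes
  \<^class>\<open>real_inner\<close> and \<^class>\<open>complete_space\<close>.\<close>

class complex_hilbert = real_inner + complete_space +
  fixes scaleC :: "complex \<Rightarrow> 'a \<Rightarrow> 'a"  (infixr "*\<^sub>C" 75)
    and cinner :: "'a \<Rightarrow> 'a \<Rightarrow> complex"
  assumes scaleC_add_right: "c *\<^sub>C (x + y) = c *\<^sub>C x + c *\<^sub>C y"
    and scaleC_add_left: "(c + e) *\<^sub>C x = c *\<^sub>C x + e *\<^sub>C x"
    and scaleC_scaleC: "c *\<^sub>C e *\<^sub>C x = (c * e) *\<^sub>C x"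
    and scaleC_of_real: "complex_of_real r *\<^sub>C x = r *\<^sub>R x"
    and cinner_commute: "cinner x y = cnj (cinner y x)"
    and cinner_add_left: "cinner (x + y) z = cinner x z + cinner y z"
    and cinner_scaleC_left: "cinner (c *\<^sub>C x) y = c * cinner x y"
    and inner_eq_Re_cinner: "x \<bullet> y = Re (cinner x y)"

text \<open>The type of \<^term>\<open>T\<close> only provides bounded real-linear maps.\<close>

definition complex_linear_op :: "('h::complex_hilbert \<Rightarrow>\<^sub>L 'h) \<Rightarrow> bool" where
  "complex_linear_op T \<longleftrightarrow> (\<forall>c x. blinfun_apply T (c *\<^sub>C x) = c *\<^sub>C blinfun_apply T x)"

definition closed_csubspace :: "'h::complex_hilbert set \<Rightarrow> bool" where
  "closed_csubspace S \<longleftrightarrow> subspace S \<and> (\<forall>c. \<forall>x\<in>S. c *\<^sub>C x \<in> S) \<and> closed S"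


section \<open>Unital C*-algebras\<close>

definition complex_ring :: "complex ring" where
  "complex_ring = \<lparr>carrier = UNIV, mult = (*), one = 1, zero = 0, add = (+)\<rparr>"

record 'a cstar = "(complex, 'a) module" +
  star :: "'a \<Rightarrow> 'a"
  cnorm :: "'a \<Rightarrow> real"

text \<open>The zero algebra is allowed.\<close>

locale unital_cstar_algebra = ring A + Module.module complex_ring A
  for A :: "'a cstar" (structure) +
  assumes smult_mult_left:
      "\<lbrakk>x \<in> carrier A; y \<in> carrier A\<rbrakk> \<Longrightarrow> (c \<odot> x) \<otimes> y = c \<odot> (x \<otimes> y)"
    and smult_mult_right:
      "\<lbrakk>x \<in> carrier A; y \<in> carrier A\<rbrakk> \<Longrightarrow> x \<otimes> (c \<odot> y) = c \<odot> (x \<otimes> y)"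
    and star_closed: "x \<in> carrier A \<Longrightarrow> star A x \<in> carrier A"
    and star_star: "x \<in> carrier A \<Longrightarrow> star A (star A x) = x"
    and star_add:
      "\<lbrakk>x \<in> carrier A; y \<in> carrier A\<rbrakk> \<Longrightarrow> star A (x \<oplus> y) = star A x \<oplus> star A y"
    and star_smult: "x \<in> carrier A \<Longrightarrow> star A (c \<odot> x) = cnj c \<odot> star A x"
    and star_mult:
      "\<lbrakk>x \<in> carrier A; y \<in> carrier A\<rbrakk> \<Longrightarrow> star A (x \<otimes> y) = star A y \<otimes> star A x"
    and cnorm_nonneg: "x \<in> carrier A \<Longrightarrow> 0 \<le> cnorm A x"
    and cnorm_eq_zero: "x \<in> carrier A \<Longrightarrow> cnorm A x = 0 \<longleftrightarrow> x = \<zero>"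
    and cnorm_triangle:
      "\<lbrakk>x \<in> carrier A; y \<in> carrier A\<rbrakk> \<Longrightarrow> cnorm A (x \<oplus> y) \<le> cnorm A x + cnorm A y"
    and cnorm_smult: "x \<in> carrier A \<Longrightarrow> cnorm A (c \<odot> x) = cmod c * cnorm A x"
    and cnorm_mult:
      "\<lbrakk>x \<in> carrier A; y \<in> carrier A\<rbrakk> \<Longrightarrow> cnorm A (x \<otimes> y) \<le> cnorm A x * cnorm A y"
    and cstar_identity: "x \<in> carrier A \<Longrightarrow> cnorm A (star A x \<otimes> x) = (cnorm A x)\<^sup>2"
    and cnorm_complete:
      "\<lbrakk>\<And>n::nat. \<sigma> n \<in> carrier A;
        \<forall>\<epsilon>>0. \<exists>N. \<forall>m\<ge>N. \<forall>n\<ge>N. cnorm A (\<sigma> m \<ominus> \<sigma> n) < \<epsilon>\<rbrakk>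
       \<Longrightarrow> \<exists>x\<in>carrier A. (\<lambda>n. cnorm A (\<sigma> n \<ominus> x)) \<longlonglongrightarrow> 0"

definition unital_star_hom :: "'a cstar \<Rightarrow> 'b cstar \<Rightarrow> ('a \<Rightarrow> 'b) \<Rightarrow> bool" where
  "unital_star_hom A B f \<longleftrightarrow> f \<in> ring_hom A B \<and>
     (\<forall>c. \<forall>x\<in>carrier A. f (c \<odot>\<^bsub>A\<^esub> x) = c \<odot>\<^bsub>B\<^esub> f x) \<and>
     (\<forall>x\<in>carrier A. f (star A x) = star B (f x))"

inductive_set star_subalgebra_gen :: "'a cstar \<Rightarrow> 'a set \<Rightarrow> 'a set"
  for A :: "'a cstar" and G :: "'a set" where
  gen: "g \<in> G \<Longrightarrow> g \<in> star_subalgebra_gen A G"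
| unit: "\<one>\<^bsub>A\<^esub> \<in> star_subalgebra_gen A G"
| add: "\<lbrakk>x \<in> star_subalgebra_gen A G; y \<in> star_subalgebra_gen A G\<rbrakk>
        \<Longrightarrow> x \<oplus>\<^bsub>A\<^esub> y \<in> star_subalgebra_gen A G"
| mult: "\<lbrakk>x \<in> star_subalgebra_gen A G; y \<in> star_subalgebra_gen A G\<rbrakk>
        \<Longrightarrow> x \<otimes>\<^bsub>A\<^esub> y \<in> star_subalgebra_gen A G"
| smult: "x \<in> star_subalgebra_gen A G \<Longrightarrow> c \<odot>\<^bsub>A\<^esub> x \<in> star_subalgebra_gen A G"
| star: "x \<in> star_subalgebra_gen A G \<Longrightarrow> star A x \<in> star_subalgebra_gen A G"

definition cstar_generated_by :: "'a cstar \<Rightarrow> 'a set \<Rightarrow> bool" where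
  "cstar_generated_by A G \<longleftrightarrow> G \<subseteq> carrier A \<and>
     (\<forall>x\<in>carrier A. \<forall>\<epsilon>>0. \<exists>p\<in>star_subalgebra_gen A G. cnorm A (x \<ominus>\<^bsub>A\<^esub> p) < \<epsilon>)"


section \<open>The universal algebra\<close>

definition satisfies_relations :: "nat \<Rightarrow> 'a cstar \<Rightarrow> (nat \<Rightarrow> 'a) \<Rightarrow> bool" where
  "satisfies_relations d A t \<longleftrightarrow>
     (\<forall>i\<in>{1..d}. t i \<in> carrier A) \<and>
     (\<forall>i\<in>{1..d}. \<forall>j\<in>{1..d}. star A (t i) \<otimes>\<^bsub>A\<^esub> t j =
        (if i = j then \<one>\<^bsub>A\<^esub> \<ominus>\<^bsub>A\<^esub> (\<Oplus>\<^bsub>A\<^esub>k\<in>{1..<i}. t k \<otimes>\<^bsub>A\<^esub> star A (t k)) else \<zero>\<^bsub>A\<^esub>)) \<and>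
     (\<forall>i\<in>{1..d}. \<forall>j\<in>{1..d}. i < j \<longrightarrow> t j \<otimes>\<^bsub>A\<^esub> t i = \<zero>\<^bsub>A\<^esub>)"

text \<open>A formula cannot quantify over all types, so the test algebras \<^term>\<open>B\<close> in the universal
  property below have their carriers inside one fixed type, the type of all maps on complex
  sequences.  This is no restriction: replacing \<^term>\<open>B\<close> by the C*-subalgebra generated by
  finitely many elements, \<^term>\<open>B\<close> may be taken separable, hence isomorphic to a C*-algebra of
  operators on the Hilbert space of square-summable sequences.  The *-homomorphisms of the
  *-algebra presented by the relations into \<^term>\<open>B\<close> are the families \<^term>\<open>s\<close> in \<^term>\<open>B\<close>
  satisfying the relations.\<close>

type_synonym sequence_map = "(nat \<Rightarrow> complex) \<Rightarrow> (nat \<Rightarrow> complex)"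

definition is_universal_algebra :: "nat \<Rightarrow> 'a cstar \<Rightarrow> (nat \<Rightarrow> 'a) \<Rightarrow> bool" where
  "is_universal_algebra d A t \<longleftrightarrow>
     unital_cstar_algebra A \<and>
     satisfies_relations d A t \<and>
     cstar_generated_by A (t ` {1..d}) \<and>
     (\<forall>(B :: sequence_map cstar) s.
        unital_cstar_algebra B \<and> satisfies_relations d B s \<longrightarrow>
        (\<exists>\<theta>. unital_star_hom A B \<theta> \<and> (\<forall>i\<in>{1..d}. \<theta> (t i) = s i)))"


section \<open>Representations\<close>

text \<open>The last conjunct says that the image of the star of an element is the Hilbert space
  adjoint of its image.  Boundedness of each operator is part of the type.\<close>

definition representation :: "'a cstar \<Rightarrow> ('a \<Rightarrow> ('h::complex_hilbert \<Rightarrow>\<^sub>L 'h)) \<Rightarrow> bool" where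
  "representation A \<pi> \<longleftrightarrow>
     (\<forall>a\<in>carrier A. complex_linear_op (\<pi> a)) \<and>
     \<pi> \<one>\<^bsub>A\<^esub> = id_blinfun \<and>
     (\<forall>a\<in>carrier A. \<forall>b\<in>carrier A. \<pi> (a \<oplus>\<^bsub>A\<^esub> b) = \<pi> a + \<pi> b) \<and>
     (\<forall>a\<in>carrier A. \<forall>b\<in>carrier A. \<pi> (a \<otimes>\<^bsub>A\<^esub> b) = \<pi> a o\<^sub>L \<pi> b) \<and>
     (\<forall>c. \<forall>a\<in>carrier A. \<forall>x. blinfun_apply (\<pi> (c \<odot>\<^bsub>A\<^esub> a)) x = c *\<^sub>C blinfun_apply (\<pi> a) x) \<and>
     (\<forall>a\<in>carrier A. \<forall>x y.
        cinner (blinfun_apply (\<pi> a) x) y = cinner x (blinfun_apply (\<pi> (star A a)) y))"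

text \<open>The requirement that the Hilbert space be nonzero is the usual one for irreducibility.\<close>

definition irreducible_representation ::
    "'a cstar \<Rightarrow> ('a \<Rightarrow> ('h::complex_hilbert \<Rightarrow>\<^sub>L 'h)) \<Rightarrow> bool" where
  "irreducible_representation A \<pi> \<longleftrightarrow> representation A \<pi> \<and>
     (UNIV :: 'h set) \<noteq> {0} \<and>
     (\<forall>S. closed_csubspace S \<and> (\<forall>a\<in>carrier A. \<forall>x\<in>S. blinfun_apply (\<pi> a) x \<in> S)
        \<longrightarrow> S = {0} \<or> S = UNIV)"

definition cyclic_vector ::
    "'a cstar \<Rightarrow> ('a \<Rightarrow> ('h::complex_hilbert \<Rightarrow>\<^sub>L 'h)) \<Rightarrow> 'h \<Rightarrow> bool" where
  "cyclic_vector A \<pi> \<Omega> \<longleftrightarrow> closure {blinfun_apply (\<pi> a) \<Omega> | a. a \<in> carrier A} = UNIV"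

definition is_Fock_representation ::
    "nat \<Rightarrow> 'a cstar \<Rightarrow> (nat \<Rightarrow> 'a) \<Rightarrow> ('a \<Rightarrow> ('h::complex_hilbert \<Rightarrow>\<^sub>L 'h)) \<Rightarrow> bool" where
  "is_Fock_representation d A t \<pi> \<longleftrightarrow> irreducible_representation A \<pi> \<and>
     (\<exists>\<Omega>. norm \<Omega> = 1 \<and> cyclic_vector A \<pi> \<Omega> \<and>
        (\<forall>i\<in>{1..d}. blinfun_apply (\<pi> (star A (t i))) \<Omega> = 0))"

definition faithful_representation ::
    "'a cstar \<Rightarrow> ('a \<Rightarrow> ('h::complex_hilbert \<Rightarrow>\<^sub>L 'h)) \<Rightarrow> bool" where
  "faithful_representation A \<pi> \<longleftrightarrow> representation A \<pi> \<and> inj_on \<pi> (carrier A)"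

end

theory Submission
  imports Defs
begin

text \<open>
  Let \<open>J\<close> be the kernel of the Fock representation \<open>\<pi>\<close> and
  \<open>P\<^sub>k = 1 - (\<Sum>i\<le>k. t\<^sub>i t\<^sub>i\<^sup>*)\<close> (\<open>defect k\<close> below).  One shows
  \<open>P\<^sub>k J = 0\<close> by descending induction on \<open>k\<close>; the case \<open>k = 0\<close> is the claim.

  Every element of the *-algebra generated by the \<open>t\<^sub>i\<close> is a combination of words \<open>t\<^sub>\<mu> t\<^sub>\<nu>\<^sup>*\<close>, so \<open>P\<^sub>d\<close> compresses
  it to multiples of \<open>P\<^sub>d\<close>, which are detected by the vacuum vector.  For the induction step put
  \<open>\<tau> = t\<^sub>k\<close>, \<open>p = P\<^bsub>k-1\<^esub>\<close>.  As \<open>P\<^sub>k J = 0\<close>, left multiplication by \<open>\<tau>\<close> is unitary on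
  \<open>p J\<close>.  For a word combination \<open>h = p q p\<close> and large \<open>D\<close> the element \<open>h \<tau>\<^sup>D\<close> is a polynomial
  in \<open>\<tau>\<close>, hence \<open>h\<^sup>N \<tau>\<^bsup>DN\<^esup>\<close> is one of degree \<open>O(N)\<close>, with coefficients at most
  \<open>\<parallel>\<pi> h\<parallel>\<^sup>N\<close> because they can be read off in Fock space.  So
  \<open>\<parallel>h\<^sup>N x\<parallel> \<le> O(N) \<parallel>\<pi> h\<parallel>\<^sup>N \<parallel>x\<parallel>\<close> for \<open>x \<in> p J\<close>, and for self-adjoint \<open>h\<close> the C*-identity
  turns this into \<open>\<parallel>h x\<parallel> \<le> \<parallel>\<pi> h\<parallel> \<parallel>x\<parallel>\<close>.  Taking \<open>h\<close> close to \<open>x x\<^sup>* \<in> J\<close> makes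
  \<open>\<parallel>\<pi> h\<parallel>\<close> arbitrarily small, whence \<open>x x\<^sup>* x = 0\<close> and \<open>x = 0\<close>.
\<close>

section \<open>C*-algebras and the Neumann series\<close>

text \<open>Not an extension of \<^locale>\<open>unital_cstar_algebra\<close>: there the module locale shadows the ring
  facts of \<open>A\<close> by those of \<^const>\<open>complex_ring\<close>.\<close>

locale cstar_algebra = ring A for A :: "'a cstar" (structure) +
  assumes unital_cstar: "unital_cstar_algebra A"
begin

lemma complex_module: "Module.module complex_ring A"
  using unital_cstar by (rule unital_cstar_algebra.axioms)

lemmas smult_mult_left = unital_cstar_algebra.smult_mult_left[OF unital_cstar]
lemmas smult_mult_right = unital_cstar_algebra.smult_mult_right[OF unital_cstar]
lemmas star_closed [simp, intro] = unital_cstar_algebra.star_closed[OF unital_cstar]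
lemmas star_star = unital_cstar_algebra.star_star[OF unital_cstar]
lemmas star_add = unital_cstar_algebra.star_add[OF unital_cstar]
lemmas star_smult = unital_cstar_algebra.star_smult[OF unital_cstar]
lemmas star_mult = unital_cstar_algebra.star_mult[OF unital_cstar]
lemmas cnorm_nonneg = unital_cstar_algebra.cnorm_nonneg[OF unital_cstar]
lemmas cnorm_eq_zero = unital_cstar_algebra.cnorm_eq_zero[OF unital_cstar]
lemmas cnorm_triangle = unital_cstar_algebra.cnorm_triangle[OF unital_cstar]
lemmas cnorm_smult = unital_cstar_algebra.cnorm_smult[OF unital_cstar]
lemmas cnorm_mult = unital_cstar_algebra.cnorm_mult[OF unital_cstar]
lemmas cstar_identity = unital_cstar_algebra.cstar_identity[OF unital_cstar]
lemmas cnorm_complete = unital_cstar_algebra.cnorm_complete[OF unital_cstar]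

lemma smult_closed [simp, intro]: "x \<in> carrier A \<Longrightarrow> c \<odot> x \<in> carrier A"
  using module.smult_closed[OF complex_module, of c x] by (simp add: complex_ring_def)

lemma smult_assoc: "x \<in> carrier A \<Longrightarrow> c \<odot> (e \<odot> x) = (c * e) \<odot> x"
  using module.smult_assoc1[OF complex_module, of c e x] by (simp add: complex_ring_def)

lemma smult_add_left: "x \<in> carrier A \<Longrightarrow> (c + e) \<odot> x = c \<odot> x \<oplus> e \<odot> x"
  using module.smult_l_distr[OF complex_module, of c e x] by (simp add: complex_ring_def)

lemma smult_add_right:
  "x \<in> carrier A \<Longrightarrow> y \<in> carrier A \<Longrightarrow> c \<odot> (x \<oplus> y) = c \<odot> x \<oplus> c \<odot> y"
  using module.smult_r_distr[OF complex_module, of c x y] by (simp add: complex_ring_def)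

lemma smult_1: "x \<in> carrier A \<Longrightarrow> 1 \<odot> x = x"
  using module.smult_one[OF complex_module, of x] by (simp add: complex_ring_def)

lemma smult_0: "x \<in> carrier A \<Longrightarrow> 0 \<odot> x = \<zero>"
  using smult_add_left[of x 0 0] by (metis add.r_cancel_one' add_0 smult_closed)

lemma minus_conv: "x \<in> carrier A \<Longrightarrow> \<ominus> x = (-1) \<odot> x"
  using smult_add_left[of x "-1" 1] by (simp add: smult_1 smult_0 minus_equality)

lemma star_zero [simp]: "star A \<zero> = \<zero>"
  using star_smult[of \<zero> 0] by (simp add: smult_0)

lemma minus_zero [simp]: "x \<in> carrier A \<Longrightarrow> x \<ominus> \<zero> = x"
  by (simp add: minus_eq)

lemma star_minus: "x \<in> carrier A \<Longrightarrow> y \<in> carrier A \<Longrightarrow> star A (x \<ominus> y) = star A x \<ominus> star A y"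
  by (simp add: minus_eq star_add minus_conv star_smult)

lemma star_one [simp]: "star A \<one> = \<one>"
  by (metis one_closed l_one r_one star_closed star_mult star_star)

text \<open>The C*-identity and submultiplicativity give one inequality after cancelling the norm of
  \<open>x\<close>; the other is the same one for \<open>star A x\<close>.\<close>

lemma cnorm_star: "x \<in> carrier A \<Longrightarrow> cnorm A (star A x) = cnorm A x"
proof -
  have le: "cnorm A x \<le> cnorm A (star A x)" if x: "x \<in> carrier A" for x
  proof (cases "cnorm A x = 0")
    case False
    have "cnorm A x * cnorm A x \<le> cnorm A (star A x) * cnorm A x"
      using cstar_identity[OF x] cnorm_mult[of "star A x" x] x by (simp add: power2_eq_square)
    thus ?thesis using False cnorm_nonneg[OF x] by simp
  qed (use that cnorm_nonneg in auto)
  assume "x \<in> carrier A"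
  thus ?thesis using le[of x] le[of "star A x"] star_star by fastforce
qed

lemma cnorm_zero [simp]: "cnorm A \<zero> = 0"
  using cnorm_eq_zero by auto

lemma cnorm_diff: "x \<in> carrier A \<Longrightarrow> y \<in> carrier A \<Longrightarrow> cnorm A (x \<ominus> y) \<le> cnorm A x + cnorm A y"
  using cnorm_triangle[of x "\<ominus> y"] cnorm_smult[of y "-1"] by (simp add: minus_eq minus_conv)

lemma cnorm_projection_le:
  assumes "p \<in> carrier A" "star A p = p" "p \<otimes> p = p"
  shows "cnorm A p \<le> 1"
proof -
  have "cnorm A p * cnorm A p = cnorm A p"
    using cstar_identity[of p] assms by (simp add: power2_eq_square)
  thus ?thesis by (cases "cnorm A p = 0") auto
qed

lemma cnorm_one_le: "cnorm A \<one> \<le> 1"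
  by (rule cnorm_projection_le) auto

lemma cnorm_pow: "x \<in> carrier A \<Longrightarrow> cnorm A (x [^] (n::nat)) \<le> cnorm A x ^ n"
proof (induction n)
  case (Suc n)
  have "cnorm A (x [^] Suc n) \<le> cnorm A (x [^] n) * cnorm A x"
    using Suc.prems cnorm_mult[of "x [^] n" x] by simp
  also have "\<dots> \<le> cnorm A x ^ n * cnorm A x"
    using Suc cnorm_nonneg by (intro mult_right_mono) auto
  finally show ?case by (simp add: mult.commute)
qed (simp add: cnorm_one_le)

lemma minus_minus_cancel:
  "x \<in> carrier A \<Longrightarrow> y \<in> carrier A \<Longrightarrow> z \<in> carrier A \<Longrightarrow> (x \<ominus> y) \<oplus> (y \<ominus> z) = x \<ominus> z"
  by algebra

lemma l_diff: "x \<in> carrier A \<Longrightarrow> y \<in> carrier A \<Longrightarrow> z \<in> carrier A \<Longrightarrow>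
    (x \<ominus> y) \<otimes> z = x \<otimes> z \<ominus> y \<otimes> z"
  by (simp add: minus_eq l_distr l_minus)

lemma r_diff: "x \<in> carrier A \<Longrightarrow> y \<in> carrier A \<Longrightarrow> z \<in> carrier A \<Longrightarrow>
    z \<otimes> (x \<ominus> y) = z \<otimes> x \<ominus> z \<otimes> y"
  by (simp add: minus_eq r_distr r_minus)

lemma minus_rearrange:
  "x \<in> carrier A \<Longrightarrow> y \<in> carrier A \<Longrightarrow> (\<one> \<ominus> x) \<ominus> y \<oplus> x = \<ominus> (y \<ominus> \<one>)"
  by algebra

text \<open>The inverse is the limit of the partial sums \<open>\<sigma> n\<close> of the geometric
  series in \<open>h\<close>, which exists by completeness. A left inverse is what bounds
  \<open>\<pi> (\<one> \<ominus> g)\<close> from below later.\<close>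

lemma neumann_inverse:
  assumes h: "h \<in> carrier A" and s: "cnorm A h < 1"
  shows "\<exists>b\<in>carrier A. b \<otimes> (\<one> \<ominus> h) = \<one>"
proof -
  define s where "s = cnorm A h"
  have s01: "0 \<le> s" "s < 1" using s cnorm_nonneg[OF h] by (auto simp: s_def)
  define \<sigma> where "\<sigma> = rec_nat \<zero> (\<lambda>n x. x \<oplus> h [^] (n::nat))"
  have \<sigma>0: "\<sigma> 0 = \<zero>" and \<sigma>S: "\<sigma> (Suc n) = \<sigma> n \<oplus> h [^] n" for n
    by (auto simp: \<sigma>_def)
  have c[simp]: "\<sigma> n \<in> carrier A" for n by (induction n) (auto simp: \<sigma>0 \<sigma>S h)
  have tel: "\<sigma> n \<otimes> (\<one> \<ominus> h) = \<one> \<ominus> h [^] n" for n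
  proof (induction n)
    case 0 show ?case using h by (simp add: \<sigma>0 minus_eq r_neg)
  next
    case (Suc n)
    have "\<sigma> (Suc n) \<otimes> (\<one> \<ominus> h) = (\<one> \<ominus> h [^] n) \<oplus> h [^] n \<otimes> (\<one> \<ominus> h)"
      using h by (simp add: \<sigma>S l_distr Suc)
    also have "\<dots> = (\<one> \<ominus> h [^] n) \<oplus> (h [^] n \<ominus> h [^] n \<otimes> h)"
      using h by (simp add: r_diff)
    finally show ?case using h by (simp add: minus_minus_cancel)
  qed
  have step: "cnorm A (\<sigma> (n + k) \<ominus> \<sigma> n) \<le> s ^ n * (1 - s ^ k) / (1 - s)" for n k
  proof (induction k)
    case 0 show ?case by (simp add: minus_eq r_neg)
  next
    case (Suc k)
    have "\<sigma> (n + Suc k) \<ominus> \<sigma> n = (\<sigma> (n + k) \<ominus> \<sigma> n) \<oplus> h [^] (n + k)"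
      using h by (simp add: \<sigma>S minus_eq) (metis c a_ac a_inv_closed nat_pow_closed)
    hence "cnorm A (\<sigma> (n + Suc k) \<ominus> \<sigma> n) \<le> cnorm A (\<sigma> (n + k) \<ominus> \<sigma> n) + s ^ (n + k)"
      using cnorm_triangle[of "\<sigma> (n + k) \<ominus> \<sigma> n" "h [^] (n + k)"] h cnorm_pow[OF h, of "n+k"]
      by (simp add: s_def)
    also have "\<dots> \<le> s ^ n * (1 - s ^ k) / (1 - s) + s ^ (n + k)" using Suc by simp
    also have "\<dots> = s ^ n * (1 - s ^ Suc k) / (1 - s)"
      using s01 by (simp add: field_simps power_add)
    finally show ?case .
  qed
  have tail: "cnorm A (\<sigma> m \<ominus> \<sigma> n) \<le> 2 * (s ^ N / (1 - s))" if "m \<ge> N" "n \<ge> N" for m n N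
  proof -
    have a: "cnorm A (\<sigma> m \<ominus> \<sigma> N) \<le> s ^ N / (1 - s)" if "m \<ge> N" for m
    proof -
      have "cnorm A (\<sigma> m \<ominus> \<sigma> N) \<le> s ^ N * (1 - s ^ (m - N)) / (1 - s)"
        using step[of N "m - N"] that by simp
      also have "\<dots> \<le> s ^ N * 1 / (1 - s)"
        using s01 by (intro divide_right_mono mult_left_mono) auto
      finally show ?thesis by simp
    qed
    have "\<sigma> m \<ominus> \<sigma> n = (\<sigma> m \<ominus> \<sigma> N) \<ominus> (\<sigma> n \<ominus> \<sigma> N)"
      using c[of m] c[of n] c[of N] by algebra
    hence "cnorm A (\<sigma> m \<ominus> \<sigma> n) \<le> cnorm A (\<sigma> m \<ominus> \<sigma> N) + cnorm A (\<sigma> n \<ominus> \<sigma> N)"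
      using cnorm_diff[of "\<sigma> m \<ominus> \<sigma> N" "\<sigma> n \<ominus> \<sigma> N"] by simp
    thus ?thesis using a[OF that(1)] a[OF that(2)] by simp
  qed
  have lim: "(\<lambda>N. 2 * (s ^ N / (1 - s))) \<longlonglongrightarrow> 2 * (0 / (1 - s))"
    using s01 by (intro tendsto_intros LIMSEQ_realpow_zero) auto
  have "\<exists>x\<in>carrier A. (\<lambda>n. cnorm A (\<sigma> n \<ominus> x)) \<longlonglongrightarrow> 0"
  proof (rule cnorm_complete)
    show "\<forall>\<epsilon>>0. \<exists>N. \<forall>m\<ge>N. \<forall>n\<ge>N. cnorm A (\<sigma> m \<ominus> \<sigma> n) < \<epsilon>"
    proof (intro allI impI)
      fix e :: real assume "e > 0"
      then obtain N where "2 * (s ^ N / (1 - s)) < e"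
        using order_tendstoD(2)[OF lim, of e] by (auto simp: eventually_sequentially)
      thus "\<exists>N. \<forall>m\<ge>N. \<forall>n\<ge>N. cnorm A (\<sigma> m \<ominus> \<sigma> n) < e"
        using tail by (meson order_le_less_trans)
    qed
  qed simp
  then obtain b where b: "b \<in> carrier A" and blim: "(\<lambda>n. cnorm A (\<sigma> n \<ominus> b)) \<longlonglongrightarrow> 0" by blast
  \<comment> \<open>The error \<open>u\<close> does not depend on \<open>n\<close>, while
    \<open>(\<sigma> n \<ominus> b) \<otimes> (\<one> \<ominus> h) \<oplus> h [^] n\<close> equals
    \<open>\<ominus> u\<close> and tends to zero in norm.\<close>
  define u where "u = b \<otimes> (\<one> \<ominus> h) \<ominus> \<one>"
  have u: "u \<in> carrier A" using b h by (simp add: u_def)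
  have bd: "cnorm A u \<le> cnorm A (\<sigma> n \<ominus> b) * cnorm A (\<one> \<ominus> h) + s ^ n" for n
  proof -
    have "(\<sigma> n \<ominus> b) \<otimes> (\<one> \<ominus> h) \<oplus> h [^] n = (\<one> \<ominus> h [^] n) \<ominus> b \<otimes> (\<one> \<ominus> h) \<oplus> h [^] n"
      using b h by (simp add: l_diff tel)
    also have "\<dots> = \<ominus> u"
      unfolding u_def using minus_rearrange[of "h [^] n" "b \<otimes> (\<one> \<ominus> h)"] b h by simp
    finally have "cnorm A (\<ominus> u) \<le> cnorm A ((\<sigma> n \<ominus> b) \<otimes> (\<one> \<ominus> h)) + cnorm A (h [^] n)"
      using cnorm_triangle[of "(\<sigma> n \<ominus> b) \<otimes> (\<one> \<ominus> h)" "h [^] n"] b h by simp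
    moreover have "cnorm A (\<ominus> u) = cnorm A u" using u cnorm_smult[of u "-1"] by (simp add: minus_conv)
    ultimately show ?thesis
      using cnorm_mult[of "\<sigma> n \<ominus> b" "\<one> \<ominus> h"] b h cnorm_pow[OF h, of n] by (simp add: s_def)
  qed
  have "(\<lambda>n. cnorm A (\<sigma> n \<ominus> b) * cnorm A (\<one> \<ominus> h) + s ^ n) \<longlonglongrightarrow> 0 * cnorm A (\<one> \<ominus> h) + 0"
    using s01 by (intro tendsto_intros blim LIMSEQ_realpow_zero) auto
  hence "cnorm A u \<le> 0"
    using LIMSEQ_le_const[of _ 0 "cnorm A u"] bd by auto
  hence "u = \<zero>" using cnorm_nonneg[OF u] cnorm_eq_zero[OF u] by simp
  moreover have "b \<otimes> (\<one> \<ominus> h) = u \<oplus> \<one>"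
    unfolding u_def using b h by (simp add: minus_eq a_assoc l_neg)
  ultimately have "b \<otimes> (\<one> \<ominus> h) = \<one>" by simp
  thus ?thesis using b by blast
qed

end

section \<open>Representations are contractive\<close>

lemma cinner_self: "cinner x x = complex_of_real ((norm x)\<^sup>2)"
proof -
  have "Im (cinner x x) = - Im (cinner x x)"
    using arg_cong[OF cinner_commute[of x x], of Im] by simp
  moreover have "Re (cinner x x) = (norm x)\<^sup>2"
    using inner_eq_Re_cinner[of x x] by (simp add: power2_norm_eq_inner)
  ultimately show ?thesis by (simp add: complex_eq_iff)
qed

lemma norm_scaleC: "norm (c *\<^sub>C x) = cmod c * norm x"
proof -
  have "cinner (c *\<^sub>C x) (c *\<^sub>C x) = c * cnj (c * cinner x x)"
    by (metis cinner_scaleC_left cinner_commute)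
  also have "\<dots> = complex_of_real ((cmod c * norm x)\<^sup>2)"
    by (simp add: cinner_self power_mult_distrib flip: complex_norm_square)
  finally have "(norm (c *\<^sub>C x))\<^sup>2 = (cmod c * norm x)\<^sup>2"
    unfolding cinner_self of_real_eq_iff .
  thus ?thesis by (simp add: power2_eq_iff_nonneg)
qed

lemma scaleC_zero [simp]: "c *\<^sub>C 0 = 0"
  by (metis norm_eq_zero norm_scaleC mult_zero_right)

text \<open>Multiplying \<open>x\<close> by the conjugate of the inner product makes the inner
  product real and nonnegative, so that the real Cauchy-Schwarz inequality applies.\<close>

lemma cinner_Cauchy_Schwarz: "cmod (cinner x y) \<le> norm x * norm y"
proof (cases "cinner x y = 0")
  case False
  let ?c = "cinner x y"
  have "cmod ?c * cmod ?c = (cnj ?c *\<^sub>C x) \<bullet> y"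
    by (simp add: inner_eq_Re_cinner cinner_scaleC_left complex_mult_cnj cmod_def
        flip: power2_eq_square)
  also have "\<dots> \<le> cmod ?c * (norm x * norm y)"
    using norm_cauchy_schwarz[of "cnj ?c *\<^sub>C x" y] by (simp add: norm_scaleC mult.assoc)
  finally show ?thesis using False by simp
qed simp

locale cstar_representation = cstar_algebra A for A :: "'a cstar" (structure) +
  fixes \<pi> :: "'a \<Rightarrow> ('h::complex_hilbert \<Rightarrow>\<^sub>L 'h)"
  assumes rep: "representation A \<pi>"
begin

lemma rep_one [simp]: "\<pi> \<one> = id_blinfun"
  and rep_add: "a \<in> carrier A \<Longrightarrow> b \<in> carrier A \<Longrightarrow> \<pi> (a \<oplus> b) = \<pi> a + \<pi> b"
  and rep_mult: "a \<in> carrier A \<Longrightarrow> b \<in> carrier A \<Longrightarrow> \<pi> (a \<otimes> b) x = \<pi> a (\<pi> b x)"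
  and rep_smult: "a \<in> carrier A \<Longrightarrow> \<pi> (c \<odot> a) x = c *\<^sub>C \<pi> a x"
  and rep_adj: "a \<in> carrier A \<Longrightarrow> cinner (\<pi> a x) y = cinner x (\<pi> (star A a) y)"
  using rep unfolding representation_def by auto

lemma rep_zero [simp]: "\<pi> \<zero> = 0"
  using rep_add[of \<zero> \<zero>] by simp

lemma rep_minus:
  assumes "a \<in> carrier A" "b \<in> carrier A"
  shows "\<pi> (a \<ominus> b) = \<pi> a - \<pi> b"
proof -
  have "(a \<ominus> b) \<oplus> b = a" using assms by algebra
  thus ?thesis using rep_add[of "a \<ominus> b" b] assms by (metis add_diff_cancel minus_closed)
qed

lemma rep_smult_real: "a \<in> carrier A \<Longrightarrow> \<pi> (complex_of_real r \<odot> a) x = r *\<^sub>R \<pi> a x"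
  by (simp add: rep_smult scaleC_of_real)

lemma norm_rep_sq:
  assumes a: "a \<in> carrier A"
  shows "(norm (\<pi> a x))\<^sup>2 = \<pi> (star A a \<otimes> a) x \<bullet> x"
proof -
  have "(norm (\<pi> a x))\<^sup>2 = x \<bullet> \<pi> (star A a \<otimes> a) x"
    using rep_adj[OF a, of x "\<pi> a x"] a
    by (simp add: power2_norm_eq_inner inner_eq_Re_cinner rep_mult)
  thus ?thesis by (simp add: inner_commute)
qed

text \<open>If \<open>r = \<parallel>\<pi> h\<parallel>\<close> exceeded \<open>\<parallel>h\<parallel>\<close>, then \<open>r\<^sup>2 - h\<^sup>2\<close> would be invertible, so
  \<open>r\<^sup>2 - (\<pi> h)\<^sup>2\<close> would be bounded below, although \<open>r\<close> is the operator norm of \<open>\<pi> h\<close>.\<close>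

lemma norm_rep_self_adjoint_le:
  assumes h: "h \<in> carrier A" "star A h = h"
  shows "norm (\<pi> h) \<le> cnorm A h"
proof (rule ccontr)
  define r where "r = norm (\<pi> h)"
  assume "\<not> norm (\<pi> h) \<le> cnorm A h"
  hence r: "cnorm A h < r" "0 < r" using cnorm_nonneg[OF h(1)] by (auto simp: r_def)
  define g where "g = complex_of_real (1 / r\<^sup>2) \<odot> (h \<otimes> h)"
  have g: "g \<in> carrier A" using h by (simp add: g_def)
  have "cnorm A g = cnorm A (h \<otimes> h) / r\<^sup>2"
    using h r by (simp add: g_def cnorm_smult norm_divide norm_power)
  also have "\<dots> \<le> cnorm A h * cnorm A h / r\<^sup>2"
    using cnorm_mult[of h h] h by (intro divide_right_mono) auto
  also have "\<dots> < 1"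
    using r cnorm_nonneg[OF h(1)] by (simp add: power2_eq_square mult_strict_mono')
  finally obtain b where b: "b \<in> carrier A" "b \<otimes> (\<one> \<ominus> g) = \<one>"
    using neumann_inverse[OF g] by blast
  \<comment> \<open>Adding 1 makes \<open>K \<ge> 1\<close>, so that
    \<open>1 - 1 / K\<^sup>2\<close> is nonnegative.\<close>
  define K where "K = norm (\<pi> b) + 1"
  have K: "K \<ge> 1" by (simp add: K_def)
  have bound: "norm (\<pi> h x) \<le> sqrt (r\<^sup>2 * (1 - 1 / K\<^sup>2)) * norm x" for x
  proof -
    define y where "y = \<pi> h x"
    define z where "z = \<pi> h y"
    have "x = \<pi> b (\<pi> (\<one> \<ominus> g) x)"
      using b g rep_mult[of b "\<one> \<ominus> g" x] by simp
    also have "\<pi> (\<one> \<ominus> g) x = x - (1 / r\<^sup>2) *\<^sub>R z"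
      using h rep_smult_real[of "h \<otimes> h" "1 / r\<^sup>2" x, folded g_def]
      unfolding rep_minus[OF one_closed g] by (simp add: rep_mult blinfun.diff_left z_def y_def)
    finally have "norm x \<le> norm (\<pi> b) * norm (x - (1 / r\<^sup>2) *\<^sub>R z)"
      by (metis norm_blinfun)
    also have "\<dots> \<le> K * norm (x - (1 / r\<^sup>2) *\<^sub>R z)"
      by (intro mult_right_mono) (auto simp: K_def)
    finally have "(norm x)\<^sup>2 \<le> K\<^sup>2 * (norm (x - (1 / r\<^sup>2) *\<^sub>R z))\<^sup>2"
      by (metis norm_ge_zero power_mono power_mult_distrib)
    \<comment> \<open>Expanding the square, the cross term is
      \<open>- 2 * (norm y)\<^sup>2 / r\<^sup>2\<close> because
      \<open>z \<bullet> x = (norm y)\<^sup>2\<close>, and \<open>norm z \<le> r * norm y\<close>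
      lets the quadratic term undo at most half of it.\<close>
    moreover have "(norm (x - (1 / r\<^sup>2) *\<^sub>R z))\<^sup>2 \<le> (norm x)\<^sup>2 - (norm y)\<^sup>2 / r\<^sup>2"
    proof -
      have zx: "z \<bullet> x = (norm y)\<^sup>2"
        using norm_rep_sq[of h x] h by (simp add: y_def z_def rep_mult)
      have "norm z \<le> r * norm y" using norm_blinfun[of "\<pi> h" y] by (simp add: z_def r_def)
      hence "(norm z)\<^sup>2 \<le> r\<^sup>2 * (norm y)\<^sup>2" by (metis norm_ge_zero power_mono power_mult_distrib)
      hence "(norm z)\<^sup>2 / (r\<^sup>2 * r\<^sup>2) \<le> r\<^sup>2 * (norm y)\<^sup>2 / (r\<^sup>2 * r\<^sup>2)"
        by (intro divide_right_mono) auto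
      also have "\<dots> = (norm y)\<^sup>2 / r\<^sup>2"
        using r by (intro mult_divide_mult_cancel_left) auto
      finally have "(norm z)\<^sup>2 / (r\<^sup>2 * r\<^sup>2) \<le> (norm y)\<^sup>2 / r\<^sup>2" .
      moreover have "(norm (x - (1 / r\<^sup>2) *\<^sub>R z))\<^sup>2
          = (norm x)\<^sup>2 - 2 * (norm y)\<^sup>2 / r\<^sup>2 + (norm z)\<^sup>2 / (r\<^sup>2 * r\<^sup>2)"
        using zx inner_commute[of x z] unfolding power2_norm_eq_inner
        by (simp add: inner_diff_left inner_diff_right diff_divide_distrib power4_eq_xxxx
            power2_eq_square)
      ultimately show ?thesis by simp
    qed
    ultimately have "(norm x)\<^sup>2 \<le> K\<^sup>2 * ((norm x)\<^sup>2 - (norm y)\<^sup>2 / r\<^sup>2)"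
      by (meson mult_left_mono order_trans zero_le_power2)
    hence "(norm y)\<^sup>2 \<le> r\<^sup>2 * (1 - 1 / K\<^sup>2) * (norm x)\<^sup>2"
      using r K by (simp add: field_simps)
    hence "norm y \<le> sqrt (r\<^sup>2 * (1 - 1 / K\<^sup>2) * (norm x)\<^sup>2)"
      using real_le_rsqrt by blast
    thus ?thesis by (simp add: y_def real_sqrt_mult)
  qed
  \<comment> \<open>The operator norm would be at most a number strictly smaller than
    itself.\<close>
  have "r \<le> sqrt (r\<^sup>2 * (1 - 1 / K\<^sup>2))"
    unfolding r_def using bound K by (intro norm_blinfun_bound) (auto simp: r_def)
  hence "r\<^sup>2 \<le> r\<^sup>2 * (1 - 1 / K\<^sup>2)"
    using r K by (smt (verit) real_sqrt_le_iff real_sqrt_unique)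
  thus False using r K by (simp add: field_simps)
qed

text \<open>The self-adjoint case applies to \<open>star A a \<otimes> a\<close>, and the
  C*-identity returns to \<open>a\<close>.\<close>

lemma norm_rep_le:
  assumes a: "a \<in> carrier A"
  shows "norm (\<pi> a) \<le> cnorm A a"
proof (rule norm_blinfun_bound)
  fix x
  have "(norm (\<pi> a x))\<^sup>2 \<le> norm (\<pi> (star A a \<otimes> a) x) * norm x"
    unfolding norm_rep_sq[OF a] by (rule norm_cauchy_schwarz)
  also have "\<dots> \<le> (norm (\<pi> (star A a \<otimes> a)) * norm x) * norm x"
    by (intro mult_right_mono norm_blinfun) auto
  also have "\<dots> \<le> (cnorm A (star A a \<otimes> a) * norm x) * norm x"
    using a by (intro mult_right_mono norm_rep_self_adjoint_le) (auto simp: star_mult star_star)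
  also have "\<dots> = (cnorm A a * norm x)\<^sup>2"
    using a by (simp add: cstar_identity power2_eq_square)
  finally show "norm (\<pi> a x) \<le> cnorm A a * norm x"
    using cnorm_nonneg[OF a] by (meson mult_nonneg_nonneg norm_ge_zero power2_le_imp_le)
qed (rule cnorm_nonneg[OF a])

end

section \<open>Consequences of the relations\<close>

locale relations = cstar_algebra A for A :: "'a cstar" (structure) +
  fixes d :: nat and t :: "nat \<Rightarrow> 'a"
  assumes rels: "satisfies_relations d A t"
begin

lemma t_closed: "i \<in> {1..d} \<Longrightarrow> t i \<in> carrier A"
  using rels by (simp add: satisfies_relations_def)

text \<open>Recursion removes one range projection at a time, so the facts below go by induction on
  \<open>k\<close>. \<open>defect_eq_finsum\<close> links this to the sum in the relations, where
  \<open>defect (i - 1)\<close> is the value of \<open>star A (t i) \<otimes> t i\<close>.\<close>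

primrec defect :: "nat \<Rightarrow> 'a" where
  "defect 0 = \<one>"
| "defect (Suc k) = defect k \<ominus> t (Suc k) \<otimes> star A (t (Suc k))"

lemma defect_closed: "k \<le> d \<Longrightarrow> defect k \<in> carrier A"
  by (induction k) (auto simp: t_closed)

lemma star_defect: "k \<le> d \<Longrightarrow> star A (defect k) = defect k"
  by (induction k) (auto simp: t_closed defect_closed star_minus star_mult star_star)

lemma defect_eq_finsum: "k \<le> d \<Longrightarrow> defect k = \<one> \<ominus> (\<Oplus>j\<in>{1..<Suc k}. t j \<otimes> star A (t j))"
proof (induction k)
  case 0
  show ?case by (simp add: minus_eq)
next
  case (Suc k)
  let ?f = "\<lambda>j. t j \<otimes> star A (t j)"
  have cl: "?f \<in> {1..<Suc k} \<rightarrow> carrier A" "?f (Suc k) \<in> carrier A"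
    using Suc.prems by (auto intro!: m_closed star_closed t_closed)
  have "{1..<Suc (Suc k)} = insert (Suc k) {1..<Suc k}" by auto
  hence "(\<Oplus>j\<in>{1..<Suc (Suc k)}. ?f j) = ?f (Suc k) \<oplus> (\<Oplus>j\<in>{1..<Suc k}. ?f j)"
    using cl by (simp add: finsum_insert)
  moreover have "defect (Suc k) = (\<one> \<ominus> (\<Oplus>j\<in>{1..<Suc k}. ?f j)) \<ominus> ?f (Suc k)"
    using Suc by simp
  ultimately show ?case
    using cl finsum_closed[OF cl(1)] by (simp add: minus_eq minus_add a_ac)
qed

lemma star_t_t:
  assumes "i \<in> {1..d}" "j \<in> {1..d}"
  shows "star A (t i) \<otimes> t j = (if i = j then defect (i - 1) else \<zero>)"
proof -
  have "defect (i - 1) = \<one> \<ominus> (\<Oplus>k\<in>{1..<i}. t k \<otimes> star A (t k))"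
    using defect_eq_finsum[of "i - 1"] assms(1) by (cases i) auto
  moreover have "star A (t i) \<otimes> t j =
      (if i = j then \<one> \<ominus> (\<Oplus>k\<in>{1..<i}. t k \<otimes> star A (t k)) else \<zero>)"
    using rels assms unfolding satisfies_relations_def by blast
  ultimately show ?thesis by presburger
qed

lemma t_t_zero: "i \<in> {1..d} \<Longrightarrow> j \<in> {1..d} \<Longrightarrow> i < j \<Longrightarrow> t j \<otimes> t i = \<zero>"
  using rels by (simp add: satisfies_relations_def)

lemma star_t_star_t_zero:
  "i \<in> {1..d} \<Longrightarrow> j \<in> {1..d} \<Longrightarrow> i < j \<Longrightarrow> star A (t i) \<otimes> star A (t j) = \<zero>"
  using arg_cong[OF t_t_zero[of i j], of "star A"] by (simp add: star_mult t_closed)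

text \<open>Each term \<open>t j \<otimes> star A (t j)\<close> removed from \<open>\<one>\<close>
  has \<open>j < i\<close>, and \<open>star A (t j) \<otimes> star A (t i) = \<zero>\<close> is the
  adjoint of \<open>t i \<otimes> t j = \<zero>\<close>.\<close>

lemma defect_mult_star_t:
  "i \<in> {1..d} \<Longrightarrow> k < i \<Longrightarrow> defect k \<otimes> star A (t i) = star A (t i)"
proof (induction k)
  case (Suc k)
  have "t (Suc k) \<otimes> star A (t (Suc k)) \<otimes> star A (t i) = \<zero>"
    using Suc.prems star_t_star_t_zero[of "Suc k" i] by (simp add: m_assoc t_closed)
  thus ?case using Suc by (simp add: l_diff defect_closed t_closed)
qed (simp add: t_closed)

text \<open>Of the removed terms only the one with index \<open>i\<close> meets
  \<open>star A (t i)\<close>: there \<open>star A (t i) \<otimes> t i = defect (i - 1)\<close>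
  fixes \<open>star A (t i)\<close> from the left, so everything cancels.\<close>

lemma star_t_mult_defect:
  "i \<in> {1..d} \<Longrightarrow> k \<le> d \<Longrightarrow> star A (t i) \<otimes> defect k = (if k < i then star A (t i) else \<zero>)"
proof (induction k)
  case (Suc k)
  have eq: "star A (t i) \<otimes> defect (Suc k)
      = star A (t i) \<otimes> defect k \<ominus> star A (t i) \<otimes> t (Suc k) \<otimes> star A (t (Suc k))"
    using Suc.prems by (simp add: r_diff defect_closed t_closed m_assoc)
  consider "Suc k < i" | "i = Suc k" | "i < Suc k" by linarith
  thus ?case
  proof cases
    case 2
    hence "star A (t i) \<otimes> defect k = star A (t i)"
      "star A (t i) \<otimes> t (Suc k) \<otimes> star A (t (Suc k)) = star A (t i)"
      using Suc defect_mult_star_t[of i k] by (simp_all add: star_t_t)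
    thus ?thesis using eq 2 Suc.prems t_closed by (simp add: minus_eq r_neg del: defect.simps)
  qed (use eq Suc in \<open>auto simp: star_t_t t_closed simp del: defect.simps\<close>)
qed (simp add: t_closed)

lemma t_mult_defect:
  assumes "i \<in> {1..d}" "k < i"
  shows "t i \<otimes> defect k = t i"
proof -
  have "t i \<in> carrier A" "defect k \<in> carrier A" "star A (defect k) = defect k"
    using assms by (simp_all add: t_closed defect_closed star_defect)
  thus ?thesis
    using arg_cong[OF defect_mult_star_t[OF assms], of "star A"] by (simp add: star_mult star_star)
qed

lemma defect_mult_t:
  assumes "i \<in> {1..d}" "k \<le> d"
  shows "defect k \<otimes> t i = (if k < i then t i else \<zero>)"
proof -
  have "t i \<in> carrier A" "defect k \<in> carrier A" "star A (defect k) = defect k"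
    using assms by (simp_all add: t_closed defect_closed star_defect)
  thus ?thesis
    using arg_cong[OF star_t_mult_defect[OF assms], of "star A"]
    by (simp add: star_mult star_star split: if_splits)
qed

lemma defect_idem: "k \<le> d \<Longrightarrow> defect k \<otimes> defect k = defect k"
proof (induction k)
  case (Suc k)
  let ?e = "t (Suc k) \<otimes> star A (t (Suc k))"
  have k: "Suc k \<in> {1..d}" "k \<le> d" using Suc.prems by auto
  have "defect (Suc k) \<otimes> defect (Suc k) = defect k \<otimes> defect (Suc k) \<ominus> ?e \<otimes> defect (Suc k)"
    using Suc.prems k defect_closed[of "Suc k"]
    by (simp add: l_diff defect_closed t_closed del: defect.simps)
      (simp add: l_diff defect_closed t_closed)
  also have "?e \<otimes> defect (Suc k) = \<zero>"
    using k Suc.prems defect_closed[of "Suc k"] star_t_mult_defect[of "Suc k" "Suc k"]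
    by (simp add: m_assoc t_closed del: defect.simps)
  also have "defect k \<otimes> defect (Suc k) = defect (Suc k)"
    using Suc k defect_mult_t[of "Suc k" k] by (simp add: r_diff defect_closed t_closed m_assoc[symmetric])
  finally show ?case using Suc.prems defect_closed[of "Suc k"] by (simp add: minus_eq del: defect.simps)
qed simp

lemma cnorm_defect_le: "k \<le> d \<Longrightarrow> cnorm A (defect k) \<le> 1"
  by (intro cnorm_projection_le defect_closed star_defect defect_idem)

lemma cnorm_t_le:
  assumes "i \<in> {1..d}"
  shows "cnorm A (t i) \<le> 1"
proof -
  have "(cnorm A (t i))\<^sup>2 \<le> 1"
    using cstar_identity[of "t i"] assms star_t_t[of i i] cnorm_defect_le[of "i - 1"] t_closed by auto
  thus ?thesis using power2_le_imp_le[of "cnorm A (t i)" 1] by simp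
qed

section \<open>Normally ordered words\<close>

definition word :: "nat list \<Rightarrow> 'a" where
  "word \<mu> = foldr (\<lambda>i a. t i \<otimes> a) \<mu> \<one>"

lemma word_Nil [simp]: "word [] = \<one>" and word_Cons [simp]: "word (i # \<mu>) = t i \<otimes> word \<mu>"
  by (simp_all add: word_def)

lemma word_closed: "set \<mu> \<subseteq> {1..d} \<Longrightarrow> word \<mu> \<in> carrier A"
  by (induction \<mu>) (auto simp: t_closed)

text \<open>Finite combinations of normally ordered words, with all starred letters to the right.
  Closure under products, the point of the next lemmas, makes this set contain the *-algebra
  generated by the \<open>t i\<close>.\<close>

inductive_set word_span :: "'a set" where
  base: "set \<mu> \<subseteq> {1..d} \<Longrightarrow> set \<nu> \<subseteq> {1..d} \<Longrightarrow> word \<mu> \<otimes> star A (word \<nu>) \<in> word_span"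
| add: "x \<in> word_span \<Longrightarrow> y \<in> word_span \<Longrightarrow> x \<oplus> y \<in> word_span"
| smult: "x \<in> word_span \<Longrightarrow> c \<odot> x \<in> word_span"

lemma word_span_closed: "x \<in> word_span \<Longrightarrow> x \<in> carrier A"
  by (induction rule: word_span.induct) (auto simp: word_closed)

lemma word_span_zero: "\<zero> \<in> word_span"
  using word_span.smult[OF word_span.base[of "[]" "[]"], of 0] by (simp add: smult_0)

lemma word_span_diff: "x \<in> word_span \<Longrightarrow> y \<in> word_span \<Longrightarrow> x \<ominus> y \<in> word_span"
  using word_span.add[of x "(-1) \<odot> y"] word_span.smult[of y "-1"] by (simp add: minus_eq minus_conv word_span_closed)

lemma word_span_linear:
  assumes "a \<in> carrier A" "x \<in> word_span"
    and "\<And>\<mu> \<nu>. set \<mu> \<subseteq> {1..d} \<Longrightarrow> set \<nu> \<subseteq> {1..d} \<Longrightarrow> a \<otimes> (word \<mu> \<otimes> star A (word \<nu>)) \<in> word_span"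
  shows "a \<otimes> x \<in> word_span"
  using assms(2)
proof (induction rule: word_span.induct)
  case (add x y) thus ?case using assms(1) word_span.add by (simp add: r_distr word_span_closed)
next
  case (smult x c) thus ?case using assms(1) word_span.smult by (simp add: smult_mult_right word_span_closed)
qed (use assms in blast)

lemma t_mult_word_span: "i \<in> {1..d} \<Longrightarrow> x \<in> word_span \<Longrightarrow> t i \<otimes> x \<in> word_span"
proof (rule word_span_linear)
  fix \<mu> \<nu> assume "i \<in> {1..d}" "set \<mu> \<subseteq> {1..d}" "set \<nu> \<subseteq> {1..d}"
  thus "t i \<otimes> (word \<mu> \<otimes> star A (word \<nu>)) \<in> word_span"
    using word_span.base[of "i # \<mu>" \<nu>] by (simp add: m_assoc t_closed word_closed)
qed (auto simp: t_closed)

lemma star_word_span: "x \<in> word_span \<Longrightarrow> star A x \<in> word_span"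
proof (induction rule: word_span.induct)
  case (base \<mu> \<nu>)
  thus ?case using word_span.base[of \<nu> \<mu>] by (simp add: star_mult star_star word_closed)
qed (simp_all add: star_add star_smult word_span_closed word_span.add word_span.smult)

text \<open>The last hypothesis is confined to \<open>i \<in> {1..k}\<close> and to this
  \<open>x\<close>, so that the induction hypothesis of \<open>star_t_mult_word\<close> can supply
  it.\<close>

lemma defect_mult_word_span:
  assumes "x \<in> word_span" "k \<le> d" "\<And>i. i \<in> {1..k} \<Longrightarrow> star A (t i) \<otimes> x \<in> word_span"
  shows "defect k \<otimes> x \<in> word_span"
  using assms(2,3)
proof (induction k)
  case (Suc k)
  have "defect (Suc k) \<otimes> x = defect k \<otimes> x \<ominus> t (Suc k) \<otimes> (star A (t (Suc k)) \<otimes> x)"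
    using Suc.prems assms(1) by (simp add: l_diff word_span_closed t_closed defect_closed m_assoc)
  thus ?case using Suc by (simp add: word_span_diff t_mult_word_span)
qed (use assms(1) in \<open>simp add: word_span_closed\<close>)

text \<open>A starred letter reaching the empty word extends \<open>\<nu>\<close>; meeting a letter
  \<open>t j\<close> it gives zero or leaves \<open>defect (i - 1)\<close> acting on a shorter word.
  That defect involves other letters, hence the generalisation over \<open>i\<close>.\<close>

lemma star_t_mult_word:
  assumes "set \<mu> \<subseteq> {1..d}" "set \<nu> \<subseteq> {1..d}" "i \<in> {1..d}"
  shows "star A (t i) \<otimes> (word \<mu> \<otimes> star A (word \<nu>)) \<in> word_span"
  using assms
proof (induction \<mu> arbitrary: i)
  case Nil
  have "star A (t i) \<otimes> star A (word \<nu>) = star A (word \<nu> \<otimes> t i)"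
    using Nil by (simp add: star_mult word_closed t_closed)
  moreover have "word \<nu> \<otimes> t i = word (\<nu> @ [i])" if "set \<nu> \<subseteq> {1..d}" for \<nu>
    using that Nil by (induction \<nu>) (auto simp: t_closed word_closed m_assoc)
  ultimately show ?case using word_span.base[of "[]" "\<nu> @ [i]"] Nil by (simp add: word_closed t_closed)
next
  case (Cons j \<mu>)
  let ?x = "word \<mu> \<otimes> star A (word \<nu>)"
  have "?x \<in> word_span" using Cons.prems by (intro word_span.base) auto
  hence "defect (i - 1) \<otimes> ?x \<in> word_span"
    using Cons by (intro defect_mult_word_span) auto
  moreover have "star A (t i) \<otimes> (word (j # \<mu>) \<otimes> star A (word \<nu>)) = (star A (t i) \<otimes> t j) \<otimes> ?x"
    using Cons.prems by (simp add: m_assoc t_closed word_closed)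
  ultimately show ?case using Cons.prems by (auto simp: star_t_t word_span_zero word_closed)
qed

lemma star_t_mult_word_span: "i \<in> {1..d} \<Longrightarrow> x \<in> word_span \<Longrightarrow> star A (t i) \<otimes> x \<in> word_span"
  by (rule word_span_linear) (simp_all add: t_closed star_t_mult_word)

lemma word_span_mult:
  assumes "x \<in> word_span" "y \<in> word_span"
  shows "x \<otimes> y \<in> word_span"
  using assms(1)
proof (induction rule: word_span.induct)
  case (base \<mu> \<nu>)
  have "star A (word \<nu>) \<otimes> z \<in> word_span" if "set \<nu> \<subseteq> {1..d}" "z \<in> word_span" for \<nu> z
    using that
  proof (induction \<nu> arbitrary: z)
    case (Cons i \<nu>)
    have "star A (word (i # \<nu>)) \<otimes> z = star A (word \<nu>) \<otimes> (star A (t i) \<otimes> z)"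
      using Cons.prems by (simp add: star_mult m_assoc t_closed word_closed word_span_closed)
    moreover have "star A (word \<nu>) \<otimes> (star A (t i) \<otimes> z) \<in> word_span"
      using Cons.prems by (intro Cons.IH star_t_mult_word_span) auto
    ultimately show ?case by simp
  qed (simp add: word_span_closed)
  moreover have "word \<mu> \<otimes> z \<in> word_span" if "set \<mu> \<subseteq> {1..d}" "z \<in> word_span" for \<mu> z
    using that by (induction \<mu>) (auto simp: word_span_closed m_assoc t_closed word_closed t_mult_word_span)
  ultimately show ?case using base assms(2) by (simp add: m_assoc word_closed word_span_closed)
next
  case (add x z) thus ?case using assms(2) word_span.add by (simp add: l_distr word_span_closed)
next
  case (smult x c) thus ?case using assms(2) word_span.smult by (simp add: smult_mult_left word_span_closed)
qed

lemma star_subalgebra_gen_subset_word_span: "star_subalgebra_gen A (t ` {1..d}) \<subseteq> word_span"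
proof
  fix x assume "x \<in> star_subalgebra_gen A (t ` {1..d})"
  thus "x \<in> word_span"
  proof (induction rule: star_subalgebra_gen.induct)
    case (gen g)
    thus ?case using word_span.base[of "[_]" "[]"] by (auto simp: t_closed)
  next
    case unit
    show ?case using word_span.base[of "[]" "[]"] by simp
  qed (auto intro: word_span.intros word_span_mult star_word_span)
qed

end

section \<open>Norm estimates\<close>

text \<open>An exponential with ratio \<open>u / \<gamma> > 1\<close> would outgrow a linear factor.
  Only exponents \<open>2 ^ n\<close> occur, since the C*-identity is used by repeated
  squaring.\<close>

lemma le_if_power_le:
  fixes u \<gamma> :: real and m :: nat
  assumes "0 < \<gamma>" and le: "\<And>n::nat. u ^ (2 ^ n) \<le> (real m * 2 ^ n + 1) * \<gamma> ^ (2 ^ n)"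
  shows "u \<le> \<gamma>"
proof (rule ccontr)
  assume "\<not> u \<le> \<gamma>"
  define q where "q = u / \<gamma>"
  have q: "q > 1" using \<open>\<not> u \<le> \<gamma>\<close> \<open>0 < \<gamma>\<close> by (simp add: q_def)
  have "(\<lambda>n. m * (real n / q ^ n) + inverse q ^ n) \<longlonglongrightarrow> real m * 0 + 0"
    using q by (intro tendsto_intros lim_n_over_pown LIMSEQ_realpow_zero) (auto simp: inverse_less_1_iff)
  hence "eventually (\<lambda>n. m * (real n / q ^ n) + inverse q ^ n < 1) sequentially"
    by (intro order_tendstoD(2)) auto
  then obtain N where N: "\<And>n. n \<ge> N \<Longrightarrow> m * (real n / q ^ n) + inverse q ^ n < 1"
    by (auto simp: eventually_sequentially)
  \<comment> \<open>An exponent that is both a power of two and at least \<open>N\<close>.\<close>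
  define M :: nat where "M = 2 ^ N"
  have "M \<ge> N" by (simp add: M_def less_imp_le)
  hence "m * (real M / q ^ M) + inverse q ^ M < 1" using N by blast
  hence "(m * real M + 1) / q ^ M < 1"
    by (simp add: add_divide_distrib power_inverse inverse_eq_divide power_divide)
  hence "(m * real M + 1) < q ^ M" using q by simp
  moreover have "q ^ M \<le> m * real M + 1"
    using le[of N] \<open>0 < \<gamma>\<close> by (simp add: q_def power_divide divide_le_eq M_def)
  ultimately show False by simp
qed

context cstar_algebra
begin

lemma diff_add_cancel: "x \<in> carrier A \<Longrightarrow> y \<in> carrier A \<Longrightarrow> (x \<ominus> y) \<oplus> y = x"
  by (simp add: minus_eq a_assoc l_neg)

lemma eq_zero_if_cnorm_le:
  assumes "x \<in> carrier A" "\<And>\<epsilon>. 0 < \<epsilon> \<Longrightarrow> cnorm A x \<le> C * \<epsilon>"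
  shows "x = \<zero>"
proof -
  have "cnorm A x \<le> 0"
  proof (rule field_le_epsilon)
    fix e :: real assume e: "0 < e"
    \<comment> \<open>The constant \<open>C\<close> may be zero or negative, so the division is by
      \<open>\<bar>C\<bar> + 1\<close>.\<close>
    have "cnorm A x \<le> C * (e / (\<bar>C\<bar> + 1))" using assms(2)[of "e / (\<bar>C\<bar> + 1)"] e by simp
    also have "\<dots> \<le> (\<bar>C\<bar> + 1) * (e / (\<bar>C\<bar> + 1))" using e by (intro mult_right_mono) auto
    finally show "cnorm A x \<le> 0 + e" by simp
  qed
  thus ?thesis using assms(1) cnorm_nonneg cnorm_eq_zero by fastforce
qed

lemma eq_zero_if_star_mult:
  assumes "x \<in> carrier A" "star A x \<otimes> x = \<zero>"
  shows "x = \<zero>"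
  using assms cstar_identity[of x] cnorm_eq_zero[of x] by simp

lemma cnorm_mult_left_le:
  assumes "p \<in> carrier A" "x \<in> carrier A" "cnorm A p \<le> 1"
  shows "cnorm A (p \<otimes> x) \<le> cnorm A x"
  using cnorm_mult[of p x] mult_right_mono[of "cnorm A p" 1 "cnorm A x"] assms cnorm_nonneg[of x]
  by simp

lemma cnorm_mult_right_le:
  assumes "p \<in> carrier A" "x \<in> carrier A" "cnorm A p \<le> 1"
  shows "cnorm A (x \<otimes> p) \<le> cnorm A x"
  using cnorm_mult[of x p] mult_left_mono[of "cnorm A p" 1 "cnorm A x"] assms cnorm_nonneg[of x]
  by simp

lemma star_pow: "x \<in> carrier A \<Longrightarrow> star A x = x \<Longrightarrow> star A (x [^] (n::nat)) = x [^] n"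
proof (induction n)
  case (Suc n)
  thus ?case using nat_pow_Suc2[of x n] by (simp add: star_mult)
qed simp

text \<open>By the C*-identity the squared norm of \<open>h [^] N \<otimes> x\<close> is the norm of
  \<open>star A x \<otimes> (h [^] (2 * N) \<otimes> x)\<close>, hence at most the norm of
  \<open>x\<close> times that of \<open>h [^] (2 * N) \<otimes> x\<close>. Each doubling of the
  exponent squares the ratio.\<close>

lemma cnorm_self_adjoint_power:
  assumes h: "h \<in> carrier A" "star A h = h" and x: "x \<in> carrier A" "cnorm A x > 0"
  shows "(cnorm A (h \<otimes> x) / cnorm A x) ^ (2 ^ n) \<le> cnorm A (h [^] (2 ^ n :: nat) \<otimes> x) / cnorm A x"
proof (induction n)
  case (Suc n)
  let ?N = "2 ^ n :: nat"
  let ?y = "h [^] ?N \<otimes> x"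
  have "star A ?y \<otimes> ?y = star A x \<otimes> (h [^] ?N \<otimes> h [^] ?N \<otimes> x)"
    using h x by (simp add: star_mult star_pow m_assoc)
  also have "h [^] ?N \<otimes> h [^] ?N = h [^] (2 ^ Suc n :: nat)"
    using h by (simp add: nat_pow_mult mult_2)
  finally have "(cnorm A ?y)\<^sup>2 \<le> cnorm A x * cnorm A (h [^] (2 ^ Suc n :: nat) \<otimes> x)"
    using cstar_identity[of ?y] cnorm_mult[of "star A x" "h [^] (2 ^ Suc n :: nat) \<otimes> x"] h x
    by (simp add: cnorm_star del: power_Suc)
  hence "(cnorm A ?y / cnorm A x)\<^sup>2 \<le> cnorm A (h [^] (2 ^ Suc n :: nat) \<otimes> x) / cnorm A x"
    using x(2) by (simp add: power2_eq_square divide_simps del: power_Suc) (simp add: mult.commute)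
  moreover have "((cnorm A (h \<otimes> x) / cnorm A x) ^ ?N)\<^sup>2 \<le> (cnorm A ?y / cnorm A x)\<^sup>2"
    using Suc x cnorm_nonneg[of "h \<otimes> x"] h by (intro power_mono) auto
  ultimately show ?case by (simp add: power_mult mult.commute flip: power_even_eq)
qed (use h x in simp)

end

context cstar_representation
begin

lemma rep_mult_zero_left: "a \<in> carrier A \<Longrightarrow> b \<in> carrier A \<Longrightarrow> \<pi> a = 0 \<Longrightarrow> \<pi> (a \<otimes> b) = 0"
  and rep_mult_zero_right: "a \<in> carrier A \<Longrightarrow> b \<in> carrier A \<Longrightarrow> \<pi> b = 0 \<Longrightarrow> \<pi> (a \<otimes> b) = 0"
  by (rule blinfun_eqI, simp add: rep_mult)+

lemma norm_rep_apply_le: "a \<in> carrier A \<Longrightarrow> norm (\<pi> a x) \<le> cnorm A a * norm x"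
  using order_trans[OF norm_blinfun mult_right_mono[OF norm_rep_le norm_ge_zero]] .

lemma norm_rep_pow_le:
  assumes "h \<in> carrier A" "norm (\<pi> h) \<le> \<gamma>"
  shows "norm (\<pi> (h [^] (N::nat)) x) \<le> \<gamma> ^ N * norm x"
proof (induction N arbitrary: x)
  case (Suc N)
  have "0 \<le> \<gamma>" using assms(2) norm_ge_zero order_trans by blast
  have "norm (\<pi> (h [^] Suc N) x) \<le> \<gamma> ^ N * norm (\<pi> h x)"
    using Suc assms(1) by (simp add: rep_mult)
  also have "\<dots> \<le> \<gamma> ^ N * (\<gamma> * norm x)"
    using assms(2) \<open>0 \<le> \<gamma>\<close>
    by (intro mult_left_mono order_trans[OF norm_blinfun] mult_right_mono zero_le_power) auto
  finally show ?case by (simp add: mult_ac)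
qed simp

end

section \<open>The vacuum corner\<close>

locale fock = relations A d t + cstar_representation A \<pi>
  for A :: "'a cstar" (structure) and d t and \<pi> :: "'a \<Rightarrow> ('h::complex_hilbert \<Rightarrow>\<^sub>L 'h)" +
  fixes \<Omega> :: 'h
  assumes gen: "cstar_generated_by A (t ` {1..d})"
    and norm_vac: "norm \<Omega> = 1"
    and star_t_vac: "i \<in> {1..d} \<Longrightarrow> \<pi> (star A (t i)) \<Omega> = 0"
begin

lemma defect_vac: "k \<le> d \<Longrightarrow> \<pi> (defect k) \<Omega> = \<Omega>"
proof (induction k)
  case (Suc k)
  thus ?case by (simp add: rep_minus rep_mult defect_closed t_closed blinfun.diff_left star_t_vac)
qed simp

lemma word_span_dense:
  assumes "g \<in> carrier A" "\<epsilon> > 0"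
  shows "\<exists>q\<in>word_span. cnorm A (g \<ominus> q) < \<epsilon>"
proof -
  have "\<exists>q\<in>star_subalgebra_gen A (t ` {1..d}). cnorm A (g \<ominus> q) < \<epsilon>"
    using gen assms by (simp add: cstar_generated_by_def)
  thus ?thesis using star_subalgebra_gen_subset_word_span by auto
qed

lemma word_span_dense_self_adjoint:
  assumes g: "g \<in> carrier A" "star A g = g" and "\<epsilon> > 0"
  shows "\<exists>q\<in>word_span. star A q = q \<and> cnorm A (g \<ominus> q) < \<epsilon>"
proof -
  obtain q where q: "q \<in> word_span" "cnorm A (g \<ominus> q) < \<epsilon>" using word_span_dense assms by blast
  note qc = word_span_closed[OF q(1)]
  \<comment> \<open>The self-adjoint part of \<open>q\<close>; as \<open>g\<close> is self-adjoint,
    \<open>g \<ominus> r\<close> is the self-adjoint part of \<open>g \<ominus> q\<close> and no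
    larger in norm.\<close>
  define r where "r = (1/2) \<odot> (q \<oplus> star A q)"
  have "r \<in> word_span" "star A r = r"
    using q qc by (auto simp: r_def star_smult star_add star_star a_comm intro: word_span.intros star_word_span)
  moreover have "cnorm A (g \<ominus> r) < \<epsilon>"
  proof -
    have "(1/2) \<odot> (g \<oplus> g) = (1/2) \<odot> g \<oplus> (1/2) \<odot> g" using g by (simp add: smult_add_right)
    also have "\<dots> = g" using g by (simp add: smult_1 flip: smult_add_left)
    finally have "g \<ominus> r = (1/2) \<odot> (g \<oplus> g) \<oplus> (1/2) \<odot> ((-1) \<odot> (q \<oplus> star A q))"
      using qc g by (simp add: r_def minus_eq minus_conv smult_assoc)
    also have "\<dots> = (1/2) \<odot> ((g \<oplus> g) \<ominus> (q \<oplus> star A q))"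
      using qc g by (simp add: smult_add_right minus_eq minus_conv)
    also have "(g \<oplus> g) \<ominus> (q \<oplus> star A q) = (g \<ominus> q) \<oplus> star A (g \<ominus> q)"
      using qc g unfolding star_minus[OF g(1) qc] by (simp add: minus_eq minus_add a_ac)
    finally have "cnorm A (g \<ominus> r) \<le> (1/2) * (cnorm A (g \<ominus> q) + cnorm A (star A (g \<ominus> q)))"
      using qc g cnorm_triangle[of "g \<ominus> q" "star A (g \<ominus> q)"] by (simp add: cnorm_smult)
    thus ?thesis using q g qc by (simp add: cnorm_star)
  qed
  ultimately show ?thesis by blast
qed

text \<open>\<open>defect d\<close> kills every \<open>t i\<close> on its right and every
  \<open>star A (t i)\<close> on its left, so only the word with \<open>\<mu>\<close> and
  \<open>\<nu>\<close> empty survives.\<close>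

lemma vacuum_corner:
  assumes "q \<in> word_span"
  shows "\<exists>c. defect d \<otimes> (q \<otimes> defect d) = c \<odot> defect d"
  using assms
proof (induction rule: word_span.induct)
  case (base \<mu> \<nu>)
  have zero: "\<exists>c. \<zero> = c \<odot> defect d" using smult_0[of "defect d"] defect_closed[of d] by (metis order_refl)
  show ?case
  proof (cases \<mu>)
    case (Cons i \<mu>')
    have "defect d \<otimes> (word \<mu> \<otimes> star A (word \<nu>) \<otimes> defect d)
        = (defect d \<otimes> t i) \<otimes> (word \<mu>' \<otimes> star A (word \<nu>) \<otimes> defect d)"
      using base Cons by (simp add: m_assoc defect_closed t_closed word_closed)
    also have "\<dots> = \<zero>" using base Cons by (simp add: defect_mult_t defect_closed word_closed)
    finally show ?thesis using zero by simp
  next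
    case Nil
    show ?thesis
    proof (cases \<nu>)
      case Nil
      thus ?thesis using \<open>\<mu> = []\<close> defect_closed[of d] by (auto simp: defect_idem smult_1 intro!: exI[of _ 1])
    next
      case (Cons i \<nu>')
      have "star A (word \<nu>) \<otimes> defect d = star A (word \<nu>') \<otimes> (star A (t i) \<otimes> defect d)"
        using base Cons by (simp add: m_assoc defect_closed t_closed word_closed star_mult)
      also have "\<dots> = \<zero>" using base Cons by (simp add: star_t_mult_defect defect_closed word_closed)
      finally show ?thesis using zero \<open>\<mu> = []\<close> base by (simp add: defect_closed word_closed)
    qed
  qed
next
  case (add x y)
  then obtain c e where "defect d \<otimes> (x \<otimes> defect d) = c \<odot> defect d"
      "defect d \<otimes> (y \<otimes> defect d) = e \<odot> defect d" by blast
  hence "defect d \<otimes> ((x \<oplus> y) \<otimes> defect d) = (c + e) \<odot> defect d"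
    using add by (simp add: l_distr r_distr word_span_closed defect_closed smult_add_left)
  thus ?case by blast
next
  case (smult x c)
  then obtain e where "defect d \<otimes> (x \<otimes> defect d) = e \<odot> defect d" by blast
  hence "defect d \<otimes> ((c \<odot> x) \<otimes> defect d) = (c * e) \<odot> defect d"
    using smult by (simp add: smult_mult_left smult_mult_right word_span_closed defect_closed smult_assoc)
  thus ?case by blast
qed

text \<open>Approximating \<open>g = a \<otimes> star A a\<close> by words makes
  \<open>p \<otimes> (g \<otimes> p)\<close> nearly a multiple of \<open>p\<close>, and the vacuum
  shows that this multiple is small because \<open>\<pi> g = 0\<close>.\<close>

lemma last_defect_annihilates_kernel:
  assumes a: "a \<in> carrier A" "\<pi> a = 0"
  shows "defect d \<otimes> a = \<zero>"
proof -
  define p where "p = defect d"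
  have p: "p \<in> carrier A" "star A p = p" "cnorm A p \<le> 1" "\<pi> p \<Omega> = \<Omega>"
    by (auto simp: p_def defect_closed star_defect cnorm_defect_le defect_vac)
  define g where "g = a \<otimes> star A a"
  have g: "g \<in> carrier A" "\<pi> g = 0" using a by (auto simp: g_def rep_mult_zero_left)
  have "p \<otimes> (g \<otimes> p) = \<zero>"
  proof (rule eq_zero_if_cnorm_le[where C = 2])
    fix \<epsilon> :: real assume "0 < \<epsilon>"
    then obtain q where q: "q \<in> word_span" "cnorm A (g \<ominus> q) < \<epsilon>" using word_span_dense g by blast
    note qc = word_span_closed[OF q(1)]
    obtain c where c: "p \<otimes> (q \<otimes> p) = c \<odot> p" using vacuum_corner[OF q(1)] p_def by blast
    have "p \<otimes> ((g \<ominus> q) \<otimes> p) = p \<otimes> (g \<otimes> p) \<ominus> c \<odot> p"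
      using g p qc by (simp add: l_diff r_diff flip: c)
    hence eq: "p \<otimes> (g \<otimes> p) = p \<otimes> ((g \<ominus> q) \<otimes> p) \<oplus> c \<odot> p"
      using g p by (simp add: minus_eq a_assoc l_neg)
    have le: "cnorm A (p \<otimes> ((g \<ominus> q) \<otimes> p)) \<le> \<epsilon>"
      using cnorm_mult_left_le[of p "(g \<ominus> q) \<otimes> p"] cnorm_mult_right_le[of p "g \<ominus> q"] p g q qc by simp
    \<comment> \<open>Since \<open>\<pi> g = 0\<close> and \<open>\<pi> p\<close> fixes
      \<open>\<Omega>\<close>, the compression of \<open>g \<ominus> q\<close> exposes the scalar
      \<open>c\<close>.\<close>
    have "\<pi> (p \<otimes> ((g \<ominus> q) \<otimes> p)) \<Omega> = - (c *\<^sub>C \<Omega>)"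
      using \<open>p \<otimes> ((g \<ominus> q) \<otimes> p) = p \<otimes> (g \<otimes> p) \<ominus> c \<odot> p\<close> p g
      by (simp add: rep_minus blinfun.minus_left rep_smult rep_mult_zero_left rep_mult_zero_right)
    hence "cmod c \<le> \<epsilon>"
      using norm_rep_apply_le[of "p \<otimes> ((g \<ominus> q) \<otimes> p)" \<Omega>] le p g qc by (simp add: norm_scaleC norm_vac)
    moreover have "cmod c * cnorm A p \<le> cmod c * 1" using p by (intro mult_left_mono) auto
    ultimately have "cnorm A (c \<odot> p) \<le> \<epsilon>" using p by (simp add: cnorm_smult)
    thus "cnorm A (p \<otimes> (g \<otimes> p)) \<le> 2 * \<epsilon>"
      using cnorm_triangle[of "p \<otimes> ((g \<ominus> q) \<otimes> p)" "c \<odot> p"] le p g qc by (simp add: eq)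
  qed (use p g in simp)
  moreover have "star A (star A a \<otimes> p) \<otimes> (star A a \<otimes> p) = p \<otimes> (g \<otimes> p)"
    using a(1) p(1,2) by (simp add: star_mult star_star g_def m_assoc)
  ultimately have "star A a \<otimes> p = \<zero>"
    using a(1) p(1) by (intro eq_zero_if_star_mult[of "star A a \<otimes> p"]) simp_all
  hence "star A (star A a \<otimes> p) = \<zero>" by simp
  thus ?thesis using a p by (simp add: star_mult star_star p_def)
qed

end

section \<open>The induction step\<close>

text \<open>The induction hypothesis is a locale assumption at \<open>k\<close>;
  \<open>p_annihilates_kernel\<close> below is the conclusion at \<open>k - 1\<close>.\<close>

locale fock_step = fock +
  fixes k :: nat
  assumes k: "k \<in> {1..d}"
    and defect_annihilates_kernel: "\<And>a. a \<in> carrier A \<Longrightarrow> \<pi> a = 0 \<Longrightarrow> defect k \<otimes> a = \<zero>"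
begin

definition "\<tau> = t k"
definition "p = defect (k - 1)"

lemma k_bounds [simp]: "k - Suc 0 \<le> d" "k - Suc 0 < k" "0 < k" "k \<le> d"
  using k by auto

lemma \<tau>_closed [simp, intro]: "\<tau> \<in> carrier A"
  using k by (simp add: \<tau>_def t_closed)

lemma p_closed [simp, intro]: "p \<in> carrier A"
  using k by (simp add: p_def defect_closed)

lemma star_p: "star A p = p" and p_idem: "p \<otimes> p = p"
  using k by (simp_all add: p_def star_defect defect_idem)

lemma cnorm_p: "cnorm A p \<le> 1" and cnorm_\<tau>: "cnorm A \<tau> \<le> 1"
  using k by (simp_all add: p_def \<tau>_def cnorm_defect_le cnorm_t_le)

lemma p_vac: "\<pi> p \<Omega> = \<Omega>"
  by (simp add: p_def defect_vac)

text \<open>These make \<open>\<tau>\<close> an isometry in the corner with unit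
  \<open>p\<close>.\<close>

lemma p_\<tau>: "p \<otimes> \<tau> = \<tau>" and \<tau>_p: "\<tau> \<otimes> p = \<tau>" and star_\<tau>_\<tau>: "star A \<tau> \<otimes> \<tau> = p"
  and p_star_\<tau>: "p \<otimes> star A \<tau> = star A \<tau>"
  using k by (simp_all add: p_def \<tau>_def defect_mult_t t_mult_defect star_t_t defect_mult_star_t)

lemma p_\<tau>_mult: "x \<in> carrier A \<Longrightarrow> p \<otimes> (\<tau> \<otimes> x) = \<tau> \<otimes> x"
  by (simp add: p_\<tau> flip: m_assoc)

lemma \<tau>_pow_Suc: "\<tau> [^] Suc j = \<tau> \<otimes> \<tau> [^] j"
  by (rule nat_pow_Suc2) simp

lemma p_\<tau>_pow: "p \<otimes> \<tau> [^] Suc j = \<tau> [^] Suc j"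
  unfolding \<tau>_pow_Suc by (rule p_\<tau>_mult) simp

text \<open>Polynomials in \<open>\<tau>\<close> of degree at most \<open>m\<close>, in Horner form; \<open>p\<close> is the unit of the corner.\<close>

inductive Pol :: "nat \<Rightarrow> 'a \<Rightarrow> bool" where
  Pol_0: "Pol 0 (c \<odot> p)"
| Pol_Suc: "Pol m y \<Longrightarrow> Pol (Suc m) (c \<odot> p \<oplus> \<tau> \<otimes> y)"

lemma Pol_closed: "Pol m y \<Longrightarrow> y \<in> carrier A"
  by (induction rule: Pol.induct) auto

lemma p_Pol: "Pol m y \<Longrightarrow> p \<otimes> y = y"
  by (induction rule: Pol.induct) (auto simp: smult_mult_right p_idem r_distr Pol_closed p_\<tau>_mult)

lemma Pol_Suc_mono: "Pol m y \<Longrightarrow> Pol (Suc m) y"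
proof (induction rule: Pol.induct)
  case (Pol_0 c)
  have "c \<odot> p \<oplus> \<tau> \<otimes> (0 \<odot> p) = c \<odot> p" by (simp add: smult_0)
  thus ?case using Pol.Pol_Suc[OF Pol.Pol_0[of 0], of c] by simp
qed (rule Pol.Pol_Suc)

lemma Pol_mono: "m \<le> n \<Longrightarrow> Pol m y \<Longrightarrow> Pol n y"
  by (induction rule: dec_induct) (auto intro: Pol_Suc_mono)

lemma Pol_zero: "Pol m \<zero>"
  using Pol_mono[of 0 m "0 \<odot> p"] Pol_0[of 0] by (simp add: smult_0)

lemma Pol_add: "Pol m x \<Longrightarrow> Pol m y \<Longrightarrow> Pol m (x \<oplus> y)"
proof (induction arbitrary: y rule: Pol.induct)
  case (Pol_0 c)
  then obtain e where "y = e \<odot> p" by (auto elim: Pol.cases)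
  thus ?case using Pol.Pol_0[of "c + e"] by (simp add: smult_add_left)
next
  case (Pol_Suc m x c)
  from \<open>Pol (Suc m) y\<close> obtain e z where z: "Pol m z" "y = e \<odot> p \<oplus> \<tau> \<otimes> z"
    by (auto elim: Pol.cases)
  have "(c \<odot> p \<oplus> \<tau> \<otimes> x) \<oplus> y = (c + e) \<odot> p \<oplus> \<tau> \<otimes> (x \<oplus> z)"
    using z Pol_Suc.hyps by (simp add: smult_add_left r_distr a_ac Pol_closed)
  thus ?case using Pol.Pol_Suc[OF Pol_Suc.IH[OF z(1)]] by simp
qed

lemma Pol_smult: "Pol m x \<Longrightarrow> Pol m (c \<odot> x)"
proof (induction rule: Pol.induct)
  case (Pol_0 e) show ?case using Pol.Pol_0[of "c * e"] by (simp add: smult_assoc)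
next
  case (Pol_Suc m x e)
  have "c \<odot> (e \<odot> p \<oplus> \<tau> \<otimes> x) = (c * e) \<odot> p \<oplus> \<tau> \<otimes> (c \<odot> x)"
    using Pol_Suc.hyps by (simp add: smult_add_right smult_assoc smult_mult_right Pol_closed)
  thus ?case using Pol.Pol_Suc[OF Pol_Suc.IH] by simp
qed

lemma Pol_shift: "Pol m y \<Longrightarrow> Pol (Suc m) (\<tau> \<otimes> y)"
  using Pol_Suc[of m y 0] by (simp add: smult_0 Pol_closed)

text \<open>The exponent is positive because \<open>\<tau> [^] 0\<close> is \<open>\<one>\<close>,
  which is in general not \<open>p\<close>; the same reason puts \<open>Suc\<close> into several
  exponents below.\<close>

lemma Pol_\<tau>_pow: "Pol (Suc j) (\<tau> [^] Suc j)"
proof (induction j)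
  case 0 show ?case using Pol_shift[OF Pol_0[of 1]] by (simp add: smult_1 \<tau>_p)
next
  case (Suc j)
  thus ?case using Pol_shift[OF Suc] nat_pow_Suc2[of \<tau> "Suc j"] by simp
qed

lemma Pol_mult: "Pol m x \<Longrightarrow> Pol n y \<Longrightarrow> Pol (m + n) (x \<otimes> y)"
proof (induction rule: Pol.induct)
  case (Pol_0 c)
  thus ?case using Pol_smult[of n y c] by (simp add: smult_mult_left p_Pol Pol_closed)
next
  case (Pol_Suc m x c)
  have "(c \<odot> p \<oplus> \<tau> \<otimes> x) \<otimes> y = c \<odot> y \<oplus> \<tau> \<otimes> (x \<otimes> y)"
    using Pol_Suc by (simp add: l_distr smult_mult_left p_Pol Pol_closed m_assoc)
  moreover have "Pol (Suc m + n) (c \<odot> y)"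
    by (rule Pol_mono[of n]) (use Pol_Suc Pol_smult in auto)
  ultimately show ?case using Pol_Suc Pol_shift[of "m + n" "x \<otimes> y"] by (simp add: Pol_add)
qed

lemma Pol_mult_\<tau>: "Pol m y \<Longrightarrow> y \<otimes> \<tau> = \<tau> \<otimes> y"
proof (induction rule: Pol.induct)
  case (Pol_0 c)
  show ?case by (simp add: smult_mult_left smult_mult_right p_\<tau> \<tau>_p)
next
  case (Pol_Suc m y c)
  note y = Pol_closed[OF Pol_Suc.hyps]
  have "(c \<odot> p \<oplus> \<tau> \<otimes> y) \<otimes> \<tau> = c \<odot> \<tau> \<oplus> \<tau> \<otimes> (y \<otimes> \<tau>)"
    using y by (simp add: l_distr m_assoc smult_mult_left p_\<tau>)
  also have "\<dots> = \<tau> \<otimes> (c \<odot> p \<oplus> \<tau> \<otimes> y)"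
    unfolding Pol_Suc.IH using y by (simp add: r_distr smult_mult_right \<tau>_p)
  finally show ?case .
qed

lemma Pol_mult_\<tau>_pow: "Pol m y \<Longrightarrow> y \<otimes> \<tau> [^] (n::nat) = \<tau> [^] n \<otimes> y"
proof (induction n)
  case (Suc n)
  note y = Pol_closed[OF Suc.prems]
  have "y \<otimes> \<tau> [^] Suc n = (y \<otimes> \<tau> [^] n) \<otimes> \<tau>" using y by (simp add: m_assoc)
  also have "\<dots> = (\<tau> [^] n \<otimes> y) \<otimes> \<tau>" by (simp only: Suc.IH[OF Suc.prems])
  also have "\<dots> = \<tau> [^] n \<otimes> (\<tau> \<otimes> y)" using y by (simp add: m_assoc Pol_mult_\<tau>[OF Suc.prems])
  also have "\<dots> = \<tau> [^] Suc n \<otimes> y" using y by (simp add: m_assoc)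
  finally show ?case .
qed (simp add: Pol_closed)

lemma Pol_shift_pow: "Pol m y \<Longrightarrow> Pol (m + n) (y \<otimes> \<tau> [^] (n::nat))"
proof (cases n)
  case (Suc j)
  assume "Pol m y"
  thus ?thesis using Pol_mult[OF _ Pol_\<tau>_pow[of j]] Suc by simp
qed (simp add: Pol_closed)

text \<open>The constant coefficient is \<open>\<langle>\<pi> y \<Omega>, \<Omega>\<rangle>\<close>, and \<open>\<pi> \<tau>\<^sup>*\<close> shifts the other coefficients
  down without increasing the norm of the vector.\<close>

lemma cnorm_Pol_le:
  "Pol m y \<Longrightarrow> norm (\<pi> y \<Omega>) \<le> B \<Longrightarrow> cnorm A y \<le> (real m + 1) * B"
proof (induction rule: Pol.induct)
  case (Pol_0 c)
  have "cmod c \<le> B"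
    using Pol_0 by (simp add: rep_smult p_vac norm_scaleC norm_vac)
  moreover have "cmod c * cnorm A p \<le> cmod c * 1" by (intro mult_left_mono cnorm_p) auto
  ultimately show ?case by (simp add: cnorm_smult)
next
  case (Pol_Suc m y c)
  note y = Pol_closed[OF Pol_Suc.hyps]
  define v where "v = \<pi> (c \<odot> p \<oplus> \<tau> \<otimes> y) \<Omega>"
  have v: "v = c *\<^sub>C \<Omega> + \<pi> \<tau> (\<pi> y \<Omega>)"
    using y by (simp add: v_def rep_add rep_mult blinfun.add_left rep_smult p_vac)
  have st: "\<pi> (star A \<tau>) \<Omega> = 0" using star_t_vac k by (simp add: \<tau>_def)
  \<comment> \<open>The adjoint moves \<open>\<tau>\<close> to the vacuum, which
    \<open>star A \<tau>\<close> kills; Cauchy-Schwarz with second vector \<open>0\<close> then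
    gives the zero inner product.\<close>
  have "cinner (\<pi> \<tau> (\<pi> y \<Omega>)) \<Omega> = 0"
    using rep_adj[of \<tau> "\<pi> y \<Omega>" \<Omega>] cinner_Cauchy_Schwarz[of "\<pi> y \<Omega>" 0] st by simp
  hence "cinner v \<Omega> = c"
    by (simp add: v cinner_add_left cinner_scaleC_left cinner_self norm_vac)
  hence c: "cmod c \<le> B"
    using cinner_Cauchy_Schwarz[of v \<Omega>] Pol_Suc.prems by (simp add: norm_vac v_def)
  \<comment> \<open>Applying \<open>star A \<tau>\<close> removes the factor \<open>\<tau>\<close>,
    and the constant term vanishes at the vacuum: what is left is
    \<open>\<pi> y \<Omega>\<close>.\<close>
  have "star A \<tau> \<otimes> (c \<odot> p \<oplus> \<tau> \<otimes> y) = c \<odot> (star A \<tau> \<otimes> p) \<oplus> y"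
    using y p_Pol[OF Pol_Suc.hyps]
    by (simp add: r_distr smult_mult_right star_\<tau>_\<tau> flip: m_assoc)
  moreover have "\<pi> (star A \<tau> \<otimes> (c \<odot> p \<oplus> \<tau> \<otimes> y)) \<Omega> = \<pi> (star A \<tau>) v"
    using y unfolding v_def by (intro rep_mult) auto
  moreover have "\<pi> (c \<odot> (star A \<tau> \<otimes> p) \<oplus> y) \<Omega> = \<pi> y \<Omega>"
    using y st by (simp add: rep_add rep_smult rep_mult blinfun.add_left p_vac)
  ultimately have "\<pi> (star A \<tau>) v = \<pi> y \<Omega>" by simp
  hence "norm (\<pi> y \<Omega>) \<le> cnorm A (star A \<tau>) * norm v"
    using norm_rep_apply_le[of "star A \<tau>" v] by simp
  also have "\<dots> \<le> 1 * norm v" by (intro mult_right_mono) (auto simp: cnorm_star cnorm_\<tau>)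
  finally have "cnorm A y \<le> (real m + 1) * B"
    using Pol_Suc.prems by (intro Pol_Suc.IH) (simp add: v_def)
  moreover have "cnorm A (c \<odot> p) \<le> B"
    using c mult_left_mono[OF cnorm_p, of "cmod c"] by (simp add: cnorm_smult)
  moreover have "cnorm A (\<tau> \<otimes> y) \<le> cnorm A y"
    using y by (intro cnorm_mult_left_le cnorm_\<tau>) auto
  ultimately show ?case
    using y cnorm_triangle[of "c \<odot> p" "\<tau> \<otimes> y"] by (simp add: algebra_simps)
qed

section \<open>High powers of \<open>\<tau>\<close> turn words into polynomials\<close>

lemma star_word_mult_pow:
  "set \<nu> \<subseteq> {1..d} \<Longrightarrow> length \<nu> < D \<Longrightarrow>
    star A (word \<nu>) \<otimes> \<tau> [^] D = \<zero> \<or> (\<exists>j. star A (word \<nu>) \<otimes> \<tau> [^] D = \<tau> [^] Suc j)"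
proof (induction \<nu> arbitrary: D)
  case Nil
  thus ?case by (cases D) auto
next
  case (Cons i \<nu>)
  then obtain E where D: "D = Suc E" "0 < E" "length \<nu> < E" by (cases D) auto
  have cl: "t i \<in> carrier A" "word \<nu> \<in> carrier A" using Cons.prems by (auto simp: t_closed word_closed)
  have eq: "star A (word (i # \<nu>)) \<otimes> \<tau> [^] D = star A (word \<nu>) \<otimes> ((star A (t i) \<otimes> \<tau>) \<otimes> \<tau> [^] E)"
    using cl unfolding D \<tau>_pow_Suc by (simp add: star_mult m_assoc)
  \<comment> \<open>A starred letter \<open>k\<close> absorbs one factor \<open>\<tau>\<close> and
    leaves \<open>p\<close>, any other letter gives zero. Since \<open>D\<close> exceeds the length
    of the word, a factor \<open>\<tau>\<close> remains to absorb \<open>p\<close>.\<close>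
  show ?case
  proof (cases "i = k")
    case True
    hence "star A (word (i # \<nu>)) \<otimes> \<tau> [^] D = star A (word \<nu>) \<otimes> \<tau> [^] E"
      using eq D p_\<tau>_pow[of "E - 1"] star_\<tau>_\<tau> by (simp add: \<tau>_def)
    thus ?thesis using Cons.IH[of E] Cons.prems D by simp
  next
    case False
    hence "star A (word (i # \<nu>)) \<otimes> \<tau> [^] D = \<zero>"
      using eq Cons.prems k cl by (simp add: \<tau>_def star_t_t t_closed)
    thus ?thesis by simp
  qed
qed

text \<open>Moving \<open>p\<close> to the right past \<open>t i\<close> gives zero for
  \<open>i < k\<close>; otherwise the two commute. Next to a power of \<open>\<tau>\<close>, the
  letter \<open>k\<close> raises the exponent and a larger letter gives zero.\<close>

lemma p_word_mult_pow:
  "set \<mu> \<subseteq> {1..d} \<Longrightarrow>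
    p \<otimes> (word \<mu> \<otimes> \<tau> [^] Suc j) = \<zero> \<or> (\<exists>l. p \<otimes> (word \<mu> \<otimes> \<tau> [^] Suc j) = \<tau> [^] Suc l)"
proof (induction \<mu>)
  case Nil
  show ?case using p_\<tau>_pow[of j] by auto
next
  case (Cons i \<mu>)
  let ?y = "word \<mu> \<otimes> \<tau> [^] Suc j"
  have cl: "t i \<in> carrier A" "word \<mu> \<in> carrier A" using Cons.prems by (auto simp: t_closed word_closed)
  hence eq: "p \<otimes> (word (i # \<mu>) \<otimes> \<tau> [^] Suc j) = (p \<otimes> t i) \<otimes> ?y"
    by (simp add: m_assoc del: nat_pow_Suc)
  show ?case
  proof (cases "i < k")
    case True
    hence "\<not> k - Suc 0 < i" by simp
    hence "p \<otimes> t i = \<zero>" using Cons.prems by (simp add: p_def defect_mult_t)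
    thus ?thesis using eq cl by simp
  next
    case False
    hence "k - Suc 0 < i" using k by simp
    hence "p \<otimes> t i = t i \<otimes> p" using Cons.prems by (simp add: p_def defect_mult_t t_mult_defect)
    hence eq2: "p \<otimes> (word (i # \<mu>) \<otimes> \<tau> [^] Suc j) = t i \<otimes> (p \<otimes> ?y)"
      using eq cl by (simp add: m_assoc del: nat_pow_Suc)
    consider "p \<otimes> ?y = \<zero>" | l where "p \<otimes> ?y = \<tau> [^] Suc l" using Cons by auto
    thus ?thesis
    proof cases
      case 1
      thus ?thesis using eq2 cl by simp
    next
      case (2 l)
      show ?thesis
      proof (cases "i = k")
        case True
        have "t i \<otimes> \<tau> [^] Suc l = \<tau> [^] Suc (Suc l)"
          unfolding True \<tau>_pow_Suc[of "Suc l"] by (simp only: \<tau>_def)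
        thus ?thesis using eq2 2 by metis
      next
        case i: False
        have "t i \<otimes> \<tau> = \<zero>" using False i Cons.prems k by (simp add: \<tau>_def t_t_zero)
        hence "t i \<otimes> \<tau> [^] Suc l = \<zero>"
          using cl unfolding \<tau>_pow_Suc by (simp flip: m_assoc)
        thus ?thesis using eq2 2 by simp
      qed
    qed
  qed
qed

lemma word_span_mult_pow_Pol:
  assumes "q \<in> word_span"
  shows "\<exists>D m. Pol m (p \<otimes> (q \<otimes> \<tau> [^] Suc D))"
  using assms
proof (induction rule: word_span.induct)
  case (base \<mu> \<nu>)
  let ?D = "length \<nu>"
  let ?z = "star A (word \<nu>) \<otimes> \<tau> [^] Suc ?D"
  have eq: "p \<otimes> (word \<mu> \<otimes> star A (word \<nu>) \<otimes> \<tau> [^] Suc ?D) = p \<otimes> (word \<mu> \<otimes> ?z)"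
    using base by (simp add: m_assoc word_closed del: nat_pow_Suc)
  consider "?z = \<zero>" | j where "?z = \<tau> [^] Suc j"
    using star_word_mult_pow[of \<nu> "Suc ?D"] base by auto
  hence "p \<otimes> (word \<mu> \<otimes> ?z) = \<zero> \<or> (\<exists>l. p \<otimes> (word \<mu> \<otimes> ?z) = \<tau> [^] Suc l)"
  proof cases
    case 1
    thus ?thesis using base by (simp add: word_closed)
  next
    case (2 j)
    thus ?thesis using p_word_mult_pow[of \<mu> j] base by simp
  qed
  thus ?case using eq Pol_zero Pol_\<tau>_pow by metis
next
  case (add x y)
  then obtain D m E n where *: "Pol m (p \<otimes> (x \<otimes> \<tau> [^] Suc D))" "Pol n (p \<otimes> (y \<otimes> \<tau> [^] Suc E))"
    by blast
  have cl: "x \<in> carrier A" "y \<in> carrier A" using add by (auto simp: word_span_closed)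
  \<comment> \<open>Both summands are brought to a common exponent by multiplying each by the power
    of \<open>\<tau>\<close> belonging to the other.\<close>
  have x: "p \<otimes> (x \<otimes> \<tau> [^] Suc (D + Suc E)) = p \<otimes> (x \<otimes> \<tau> [^] Suc D) \<otimes> \<tau> [^] Suc E"
    using cl nat_pow_mult[of \<tau> "Suc D" "Suc E"] by (simp add: m_assoc del: nat_pow_Suc)
  have y: "p \<otimes> (y \<otimes> \<tau> [^] Suc (D + Suc E)) = p \<otimes> (y \<otimes> \<tau> [^] Suc E) \<otimes> \<tau> [^] Suc D"
    using cl nat_pow_mult[of \<tau> "Suc E" "Suc D"] by (simp add: m_assoc add_ac del: nat_pow_Suc)
  define M where "M = (m + Suc E) + (n + Suc D)"
  have "Pol M (p \<otimes> (x \<otimes> \<tau> [^] Suc (D + Suc E)))"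
    unfolding x by (rule Pol_mono[OF _ Pol_shift_pow[OF *(1)]]) (simp add: M_def)
  moreover have "Pol M (p \<otimes> (y \<otimes> \<tau> [^] Suc (D + Suc E)))"
    unfolding y by (rule Pol_mono[OF _ Pol_shift_pow[OF *(2)]]) (simp add: M_def)
  ultimately have "Pol M (p \<otimes> ((x \<oplus> y) \<otimes> \<tau> [^] Suc (D + Suc E)))"
    using cl Pol_add by (simp add: l_distr r_distr del: nat_pow_Suc)
  thus ?case by blast
next
  case (smult x c)
  then obtain D m where "Pol m (p \<otimes> (x \<otimes> \<tau> [^] Suc D))" by blast
  hence "Pol m (p \<otimes> ((c \<odot> x) \<otimes> \<tau> [^] Suc D))"
    using Pol_smult[of m _ c] smult by (simp add: smult_mult_left smult_mult_right word_span_closed del: nat_pow_Suc)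
  thus ?case by blast
qed

text \<open>The polynomial \<open>y\<close> found for one exponent commutes with
  \<open>\<tau> [^] D\<close>, so \<open>h \<otimes> (y \<otimes> \<tau> [^] D)\<close> is
  \<open>(h \<otimes> \<tau> [^] D) \<otimes> y\<close>: degrees add and grow only linearly in the
  exponent.\<close>

lemma Pol_pow:
  assumes h: "h \<in> carrier A" "Pol m (h \<otimes> \<tau> [^] (D::nat))"
  shows "Pol (m * Suc N) (h [^] Suc N \<otimes> \<tau> [^] (D * Suc N))"
proof (induction N)
  case (Suc N)
  let ?y = "h [^] Suc N \<otimes> \<tau> [^] (D * Suc N)"
  have "h [^] Suc (Suc N) \<otimes> \<tau> [^] (D * Suc (Suc N)) = h \<otimes> (?y \<otimes> \<tau> [^] (D::nat))"
    using h nat_pow_mult[of \<tau> "D * Suc N" D] nat_pow_Suc2[of h "Suc N"]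
    by (simp add: m_assoc add_ac del: nat_pow_Suc)
  also have "\<dots> = (h \<otimes> \<tau> [^] D) \<otimes> ?y"
    unfolding Pol_mult_\<tau>_pow[OF Suc] using h by (simp add: m_assoc del: nat_pow_Suc)
  finally show ?case using Pol_mult[OF h(2) Suc] by simp
qed (use h in simp)

section \<open>Estimates on the kernel\<close>

lemma kernel_factor:
  assumes "x \<in> carrier A" "\<pi> x = 0" "p \<otimes> x = x"
  shows "\<exists>z\<in>carrier A. x = \<tau> [^] (M::nat) \<otimes> z \<and> cnorm A z \<le> cnorm A x"
  using assms
proof (induction M arbitrary: x)
  case 0 thus ?case by auto
next
  case (Suc M)
  have "Suc (k - 1) = k" using k by simp
  hence "defect k = p \<ominus> \<tau> \<otimes> star A \<tau>" using defect.simps(2)[of "k - 1"] by (simp only: p_def \<tau>_def)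
  \<comment> \<open>The induction hypothesis \<open>defect k \<otimes> x = \<zero>\<close> says that
    \<open>\<tau> \<otimes> star A \<tau>\<close> fixes \<open>x\<close>. Iterating extracts any
    power of \<open>\<tau>\<close>; the cofactor arises from \<open>x\<close> by the contraction
    \<open>star A \<tau>\<close>.\<close>
  hence "x \<ominus> \<tau> \<otimes> (star A \<tau> \<otimes> x) = \<zero>"
    using defect_annihilates_kernel[of x] Suc.prems by (simp add: l_diff m_assoc)
  hence x: "\<tau> \<otimes> (star A \<tau> \<otimes> x) = x"
    using diff_add_cancel[of x "\<tau> \<otimes> (star A \<tau> \<otimes> x)"] Suc.prems by simp
  have "p \<otimes> (star A \<tau> \<otimes> x) = star A \<tau> \<otimes> x"
    using Suc.prems by (simp add: p_star_\<tau> flip: m_assoc)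
  then obtain z where z: "z \<in> carrier A" "star A \<tau> \<otimes> x = \<tau> [^] M \<otimes> z"
      "cnorm A z \<le> cnorm A (star A \<tau> \<otimes> x)"
    using Suc.IH[of "star A \<tau> \<otimes> x"] Suc.prems by (auto simp: rep_mult_zero_right)
  have "x = \<tau> [^] Suc M \<otimes> z"
    using x z(1) unfolding \<tau>_pow_Suc by (simp add: m_assoc flip: z(2))
  moreover have "cnorm A (star A \<tau> \<otimes> x) \<le> cnorm A x"
    using Suc.prems by (intro cnorm_mult_left_le) (auto simp: cnorm_star cnorm_\<tau>)
  ultimately show ?case using z by force
qed

text \<open>Factoring \<open>\<tau> [^] (D * N)\<close> out of \<open>x\<close> replaces
  \<open>h [^] N\<close> by a polynomial of degree at most \<open>m * N\<close>, whose norm is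
  controlled by its vacuum vector.\<close>

lemma cnorm_pow_mult_kernel_le:
  assumes h: "h \<in> carrier A" "Pol m (h \<otimes> \<tau> [^] (D::nat))" "norm (\<pi> h) \<le> \<gamma>"
    and x: "x \<in> carrier A" "\<pi> x = 0" "p \<otimes> x = x" and N: "N > 0"
  shows "cnorm A (h [^] N \<otimes> x) \<le> (real (m * N) + 1) * \<gamma> ^ N * cnorm A x"
proof -
  let ?y = "h [^] N \<otimes> \<tau> [^] (D * N)"
  have "\<gamma> \<ge> 0" using h(3) norm_ge_zero order_trans by blast
  obtain z where z: "z \<in> carrier A" "x = \<tau> [^] (D * N) \<otimes> z" "cnorm A z \<le> cnorm A x"
    using kernel_factor[OF x] by blast
  have "norm (\<pi> ?y \<Omega>) \<le> \<gamma> ^ N * norm (\<pi> (\<tau> [^] (D * N)) \<Omega>)"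
    using h by (simp add: rep_mult norm_rep_pow_le)
  also have "norm (\<pi> (\<tau> [^] (D * N)) \<Omega>) \<le> 1"
    using norm_rep_apply_le[of "\<tau> [^] (D * N)" \<Omega>] cnorm_pow[of \<tau> "D * N"] cnorm_\<tau>
      power_le_one[of "cnorm A \<tau>" "D * N"] cnorm_nonneg[of \<tau>] by (simp add: norm_vac)
  finally have "norm (\<pi> ?y \<Omega>) \<le> \<gamma> ^ N" using \<open>\<gamma> \<ge> 0\<close> by (simp add: mult_left_mono)
  moreover have "Pol (m * N) ?y" using Pol_pow[OF h(1,2), of "N - 1"] N by simp
  ultimately have le: "cnorm A ?y \<le> (real (m * N) + 1) * \<gamma> ^ N" by (rule cnorm_Pol_le[rotated])
  have "h [^] N \<otimes> x = ?y \<otimes> z" using z h by (simp add: m_assoc)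
  hence "cnorm A (h [^] N \<otimes> x) \<le> cnorm A ?y * cnorm A z" using cnorm_mult[of ?y z] h z by simp
  also have "\<dots> \<le> ((real (m * N) + 1) * \<gamma> ^ N) * cnorm A x"
    using le z \<open>\<gamma> \<ge> 0\<close> cnorm_nonneg by (intro mult_mono) auto
  finally show ?thesis .
qed

text \<open>The linear factor in the previous bound disappears on taking roots along
  \<open>N = 2 ^ n\<close>, by \<open>cnorm_self_adjoint_power\<close> and
  \<open>le_if_power_le\<close>.\<close>

lemma cnorm_mult_kernel_le:
  assumes h: "h \<in> carrier A" "star A h = h" "Pol m (h \<otimes> \<tau> [^] (D::nat))" "norm (\<pi> h) \<le> \<gamma>" "0 < \<gamma>"
    and x: "x \<in> carrier A" "\<pi> x = 0" "p \<otimes> x = x"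
  shows "cnorm A (h \<otimes> x) \<le> \<gamma> * cnorm A x"
proof (cases "cnorm A x = 0")
  case True
  thus ?thesis using x h cnorm_eq_zero[of x] by simp
next
  case False
  hence pos: "cnorm A x > 0" using cnorm_nonneg[OF x(1)] by simp
  have "cnorm A (h \<otimes> x) / cnorm A x \<le> \<gamma>"
  proof (rule le_if_power_le[OF \<open>0 < \<gamma>\<close>])
    fix n :: nat
    have "cnorm A (h [^] (2 ^ n :: nat) \<otimes> x)
        \<le> (real (m * 2 ^ n) + 1) * \<gamma> ^ (2 ^ n) * cnorm A x"
      using cnorm_pow_mult_kernel_le[OF h(1,3,4) x, of "2 ^ n"] by simp
    hence "cnorm A (h [^] (2 ^ n :: nat) \<otimes> x) / cnorm A x \<le> (real (m * 2 ^ n) + 1) * \<gamma> ^ (2 ^ n)"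
      using pos by (simp add: divide_le_eq)
    thus "(cnorm A (h \<otimes> x) / cnorm A x) ^ (2 ^ n) \<le> (real m * 2 ^ n + 1) * \<gamma> ^ (2 ^ n)"
      using cnorm_self_adjoint_power[OF h(1,2) x(1) pos, of n] by simp
  qed
  thus ?thesis using pos by (simp add: divide_le_eq)
qed

lemma p_annihilates_kernel:
  assumes a: "a \<in> carrier A" "\<pi> a = 0"
  shows "p \<otimes> a = \<zero>"
proof -
  define x where "x = p \<otimes> a"
  have x: "x \<in> carrier A" "\<pi> x = 0" "p \<otimes> x = x"
    using a by (auto simp: x_def rep_mult_zero_right p_idem simp flip: m_assoc)
  define g where "g = x \<otimes> star A x"
  have g: "g \<in> carrier A" "\<pi> g = 0" "star A g = g"
    using x by (auto simp: g_def rep_mult_zero_left star_mult star_star)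
  have pg: "p \<otimes> g = g" using x by (simp add: g_def flip: m_assoc)
  hence gp: "g \<otimes> p = g" using star_mult[of p g] g by (simp add: star_p)
  have "g \<otimes> x = \<zero>"
  proof (rule eq_zero_if_cnorm_le[where C = "2 * cnorm A x"])
    fix \<epsilon> :: real assume "0 < \<epsilon>"
    then obtain q where q: "q \<in> word_span" "star A q = q" "cnorm A (g \<ominus> q) < \<epsilon>"
      using word_span_dense_self_adjoint g by blast
    note qc = word_span_closed[OF q(1)]
    \<comment> \<open>Compressing \<open>q\<close> to the corner keeps it self-adjoint and within
      \<open>\<epsilon>\<close> of \<open>g\<close>, as \<open>g\<close> already lies in the
      corner.\<close>
    define h where "h = p \<otimes> (q \<otimes> p)"
    have h: "h \<in> carrier A" "star A h = h" using qc q by (auto simp: h_def star_mult star_p m_assoc)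
    have "g \<ominus> h = p \<otimes> ((g \<ominus> q) \<otimes> p)"
      using g qc pg gp by (simp add: h_def l_diff r_diff)
    hence gh: "cnorm A (g \<ominus> h) \<le> \<epsilon>"
      using cnorm_mult_left_le[of p "(g \<ominus> q) \<otimes> p"] cnorm_mult_right_le[of p "g \<ominus> q"]
        cnorm_p g q qc by simp
    have "norm (\<pi> h) \<le> \<epsilon>"
      using norm_rep_le[of "g \<ominus> h"] gh g h by (simp add: rep_minus)
    moreover obtain D m where "Pol m (p \<otimes> (q \<otimes> \<tau> [^] Suc D))"
      using word_span_mult_pow_Pol[OF q(1)] by blast
    hence "Pol m (h \<otimes> \<tau> [^] Suc D)"
      using qc p_\<tau>_pow[of D] by (simp add: h_def m_assoc del: nat_pow_Suc)
    ultimately have "cnorm A (h \<otimes> x) \<le> \<epsilon> * cnorm A x"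
      using cnorm_mult_kernel_le[OF h _ _ \<open>0 < \<epsilon>\<close> x] by blast
    moreover have "cnorm A ((g \<ominus> h) \<otimes> x) \<le> \<epsilon> * cnorm A x"
      using cnorm_mult[of "g \<ominus> h" x] mult_right_mono[OF gh cnorm_nonneg[OF x(1)]] g h x by simp
    moreover have "g \<otimes> x = (g \<ominus> h) \<otimes> x \<oplus> h \<otimes> x"
      using g h x by (simp add: diff_add_cancel flip: l_distr)
    hence "cnorm A (g \<otimes> x) \<le> cnorm A ((g \<ominus> h) \<otimes> x) + cnorm A (h \<otimes> x)"
      using cnorm_triangle[of "(g \<ominus> h) \<otimes> x" "h \<otimes> x"] g h x by simp
    ultimately show "cnorm A (g \<otimes> x) \<le> 2 * cnorm A x * \<epsilon>"
      by (simp add: mult_ac)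
  qed (use g x in simp)
  \<comment> \<open>Here \<open>g \<otimes> x\<close> is
    \<open>x \<otimes> star A x \<otimes> x\<close>, so the square of
    \<open>star A x \<otimes> x\<close> vanishes, and the C*-identity is applied twice.\<close>
  hence "star A (star A x \<otimes> x) \<otimes> (star A x \<otimes> x) = \<zero>"
    using x by (simp add: star_mult star_star g_def m_assoc)
  hence "star A x \<otimes> x = \<zero>" using x by (intro eq_zero_if_star_mult[of "star A x \<otimes> x"]) auto
  thus ?thesis using x eq_zero_if_star_mult[of x] by (simp add: x_def)
qed

end

section \<open>Descending induction and faithfulness\<close>

context fock
begin

lemma kernel_zero:
  assumes "a \<in> carrier A" "\<pi> a = 0"
  shows "a = \<zero>"
proof -
  \<comment> \<open>Counting down by \<open>j\<close>: the case \<open>j = 0\<close> is the vacuum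
    corner, and \<open>j = d\<close> gives \<open>defect 0 = \<one>\<close>.\<close>
  have "\<forall>a\<in>carrier A. \<pi> a = 0 \<longrightarrow> defect (d - j) \<otimes> a = \<zero>" if "j \<le> d" for j
    using that
  proof (induction j)
    case 0
    show ?case using last_defect_annihilates_kernel by simp
  next
    case (Suc j)
    then interpret fock_step A d t \<pi> \<Omega> "d - j"
      by unfold_locales auto
    show ?case using p_annihilates_kernel by (auto simp: p_def)
  qed
  from this[of d] show ?thesis using assms by simp
qed

end

theorem theorem2:
  fixes d :: nat
    and A0 :: "'a cstar"
    and t :: "nat \<Rightarrow> 'a"
    and \<pi>\<^sub>F :: "'a \<Rightarrow> ('h::complex_hilbert \<Rightarrow>\<^sub>L 'h)"
  assumes "d \<ge> 1"
    and "is_universal_algebra d A0 t"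
    and "is_Fock_representation d A0 t \<pi>\<^sub>F"
  shows "faithful_representation A0 \<pi>\<^sub>F"
proof -
  have A: "unital_cstar_algebra A0" "satisfies_relations d A0 t" "cstar_generated_by A0 (t ` {1..d})"
    using assms(2) by (auto simp: is_universal_algebra_def)
  have rep: "representation A0 \<pi>\<^sub>F"
    using assms(3) by (simp add: is_Fock_representation_def irreducible_representation_def)
  obtain \<Omega> where \<Omega>: "norm \<Omega> = 1" "\<forall>i\<in>{1..d}. \<pi>\<^sub>F (star A0 (t i)) \<Omega> = 0"
    using assms(3) by (auto simp: is_Fock_representation_def)
  have "ring A0" using A(1) by (rule unital_cstar_algebra.axioms)
  then interpret fock A0 d t \<pi>\<^sub>F \<Omega>
    using A rep \<Omega>
    by (auto simp: fock_def fock_axioms_def relations_def relations_axioms_def cstar_algebra_def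
        cstar_algebra_axioms_def cstar_representation_def cstar_representation_axioms_def)
  have "inj_on \<pi>\<^sub>F (carrier A0)"
  proof (rule inj_onI)
    fix a b assume ab: "a \<in> carrier A0" "b \<in> carrier A0" "\<pi>\<^sub>F a = \<pi>\<^sub>F b"
    hence "a \<ominus>\<^bsub>A0\<^esub> b = \<zero>\<^bsub>A0\<^esub>" by (intro kernel_zero) (auto simp: rep_minus)
    thus "a = b" using diff_add_cancel[of a b] ab by simp
  qed
  with rep show ?thesis by (simp add: faithful_representation_def)
qed

end
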